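(* Consider a continuous-time multi-agent system of $N$ identical agents $\dot x_i=Ax_i+Bu_i$, $y_i=Cx_i$ ($i=1,\dots,N$), with $x_i\in\mathbb{R}^n$, $u_i\in\mathbb{R}$, $y_i\in\mathbb{R}$. Each agent receives $\zeta_i=\sum_{j=1}^N\ell_{ij}y_j$ and $\hat\zeta_i=\sum_{j=1}^N\ell_{ij}H_cx_{j,c}$, and uses a collaborative linear protocol $$\dot x_{i,c}=A_cx_{i,c}+B_c\zeta_i+E_c\hat\zeta_i,\qquad u_i=F_cx_{i,c}+G^1_c\zeta_i+G^2_c\hat\zeta_i,$$ with $x_{i,c}\in\mathbb{R}^{n_c}$. The scale-free collaborative state synchronization problem asks for fixed matrices $A_c,B_c,E_c,F_c,G_c^1,G_c^2,H_c$ (independent of $N$ and of the graph) such that for every number of agents $N$, every weighted directed graph on $N$ nodes containing a directed spanning tree, and all initial conditions of agents and protocols, $\lim_{t\to\infty}(x_i(t)-x_j(t))=0$ for all $i,j$. This problem is solvable if and only if either $A$ is asymptotically stable (Hurwitz), or all of the following hold: $(A,B)$ is stabilizable, $(C,A)$ is detectable, and all eigenvalues of $A$ lie in the closed left-half complex plane.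
   Context: The network is described by a weighted directed graph on nodes $\{1,\dots,N\}$ with weighted adjacency matrix $[a_{ij}]$, $a_{ij}\ge0$, $a_{ii}=0$, where $a_{ij}>0$ means an edge from node $j$ to node $i$. The Laplacian $L=[\ell_{ij}]$ has $\ell_{ii}=\sum_k a_{ik}$ and $\ell_{ij}=-a_{ij}$ for $i\neq j$. A directed spanning tree exists iff some node has a directed path to every other node. *)

theory Defs
  imports "HOL-Analysis.Analysis" "Jordan_Normal_Form.Char_Poly"
begin

definition hurwitz :: "real mat \<Rightarrow> bool" where
  "hurwitz M \<longleftrightarrow> (\<forall>z. eigenvalue (map_mat complex_of_real M) z \<longrightarrow> Re z < 0)"

definition eigs_closed_left :: "real mat \<Rightarrow> bool" where
  "eigs_closed_left M \<longleftrightarrow> (\<forall>z. eigenvalue (map_mat complex_of_real M) z \<longrightarrow> Re z \<le> 0)"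

definition stabilizable :: "real mat \<Rightarrow> real mat \<Rightarrow> bool" where
  "stabilizable A B \<longleftrightarrow>
     (\<exists>F \<in> carrier_mat (dim_col B) (dim_row A). hurwitz (A + B * F))"

definition detectable :: "real mat \<Rightarrow> real mat \<Rightarrow> bool" where
  "detectable C A \<longleftrightarrow>
     (\<exists>K \<in> carrier_mat (dim_row A) (dim_row C). hurwitz (A + K * C))"

(* Laplacian of the weighted graph on nodes 0..N-1 with adjacency a (a i j > 0: edge j -> i) *)
definition laplacian :: "nat \<Rightarrow> (nat \<Rightarrow> nat \<Rightarrow> real) \<Rightarrow> nat \<Rightarrow> nat \<Rightarrow> real" where
  "laplacian N a i j = (if i = j then (\<Sum>k<N. a i k) else - a i j)"

definition is_weighted_digraph :: "nat \<Rightarrow> (nat \<Rightarrow> nat \<Rightarrow> real) \<Rightarrow> bool" where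
  "is_weighted_digraph N a \<longleftrightarrow> (\<forall>i<N. \<forall>j<N. a i j \<ge> 0) \<and> (\<forall>i<N. a i i = 0)"

definition dedge :: "nat \<Rightarrow> (nat \<Rightarrow> nat \<Rightarrow> real) \<Rightarrow> nat \<Rightarrow> nat \<Rightarrow> bool" where
  "dedge N a j i \<longleftrightarrow> j < N \<and> i < N \<and> a i j > 0"

definition has_directed_spanning_tree :: "nat \<Rightarrow> (nat \<Rightarrow> nat \<Rightarrow> real) \<Rightarrow> bool" where
  "has_directed_spanning_tree N a \<longleftrightarrow> (\<exists>r<N. \<forall>i<N. (dedge N a)\<^sup>*\<^sup>* r i)"

definition has_vderiv :: "(real \<Rightarrow> real vec) \<Rightarrow> real vec \<Rightarrow> real \<Rightarrow> bool" where
  "has_vderiv f f' t \<longleftrightarrow>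
     (\<forall>k < dim_vec f'. ((\<lambda>s. f s $ k) has_real_derivative (f' $ k)) (at t within {0..}))"

definition net_sum :: "nat \<Rightarrow> (nat \<Rightarrow> nat \<Rightarrow> real) \<Rightarrow> real mat \<Rightarrow> (nat \<Rightarrow> real vec) \<Rightarrow> nat \<Rightarrow> real vec" where
  "net_sum N a M z i = vec (dim_row M) (\<lambda>k. \<Sum>j<N. laplacian N a i j * (M *\<^sub>v z j) $ k)"

definition closed_loop_solution ::
  "real mat \<Rightarrow> real mat \<Rightarrow> real mat \<Rightarrow>
   real mat \<Rightarrow> real mat \<Rightarrow> real mat \<Rightarrow> real mat \<Rightarrow> real mat \<Rightarrow> real mat \<Rightarrow> real mat \<Rightarrow>
   nat \<Rightarrow> (nat \<Rightarrow> nat \<Rightarrow> real) \<Rightarrow> (nat \<Rightarrow> real \<Rightarrow> real vec) \<Rightarrow> (nat \<Rightarrow> real \<Rightarrow> real vec) \<Rightarrow> bool" where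
  "closed_loop_solution A B C Ac Bc Ec Fc G1 G2 Hc N a x xc \<longleftrightarrow>
     (\<forall>t\<ge>0. \<forall>i<N.
        x i t \<in> carrier_vec (dim_row A) \<and> xc i t \<in> carrier_vec (dim_row Ac) \<and>
        (let \<zeta> = net_sum N a C (\<lambda>j. x j t) i;
             \<zeta>h = net_sum N a Hc (\<lambda>j. xc j t) i;
             u = Fc *\<^sub>v xc i t + G1 *\<^sub>v \<zeta> + G2 *\<^sub>v \<zeta>h
         in has_vderiv (x i) (A *\<^sub>v x i t + B *\<^sub>v u) t \<and>
            has_vderiv (xc i) (Ac *\<^sub>v xc i t + Bc *\<^sub>v \<zeta> + Ec *\<^sub>v \<zeta>h) t))"

definition scale_free_sync_solvable :: "real mat \<Rightarrow> real mat \<Rightarrow> real mat \<Rightarrow> bool" where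
  "scale_free_sync_solvable A B C \<longleftrightarrow>
    (\<exists>nc q Ac Bc Ec Fc G1 G2 Hc.
       Ac \<in> carrier_mat nc nc \<and> Bc \<in> carrier_mat nc (dim_row C) \<and> Ec \<in> carrier_mat nc q \<and>
       Fc \<in> carrier_mat (dim_col B) nc \<and> G1 \<in> carrier_mat (dim_col B) (dim_row C) \<and>
       G2 \<in> carrier_mat (dim_col B) q \<and> Hc \<in> carrier_mat q nc \<and>
       (\<forall>N a x xc.
          is_weighted_digraph N a \<and> has_directed_spanning_tree N a \<and>
          closed_loop_solution A B C Ac Bc Ec Fc G1 G2 Hc N a x xc \<longrightarrow>
          (\<forall>i<N. \<forall>j<N. \<forall>k<dim_row A.
             ((\<lambda>t. x i t $ k - x j t $ k) \<longlongrightarrow> 0) at_top)))"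

end

theory Submission
  imports Defs "Jordan_Normal_Form.Schur_Decomposition"
begin

text \<open>
  All asymptotic statements are reduced to factored annihilating polynomials. If a product of
  factors A - s with Re s < 0 vanishes, the solutions of X' = A X + g with g tending to zero decay,
  one factor at a time, through scalar equations y' = s y + f.

  Sufficiency: with A + B F and A + K C Hurwitz, agent i runs an observer Xh of the network
  quantity L X and a copy Ch of its own state, with Ch' = Xh + (A + B F) Ch - L Ch and u = F Ch. The
  deviation D = X - Ch obeys D' = A D - L D up to a decaying term. The nonzero eigenvalues of L have
  positive real part whatever the graph, so the disagreement of D decays as soon as the eigenvalues
  of A lie in the closed left half plane. A Hurwitz matrix A satisfies this with F = K = 0.

  Necessity: let one agent follow another one, at rest, along an edge of weight c. Its closed-loop
  matrix M(c) satisfies P p(M(c)) = 0 for some product p of factors with Re s < 0, where P projects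
  to the agent state. Left and right eigenvectors of M(1) coming from uncontrollable or
  unobservable modes of A give the Hautus conditions, from which feedback gains are built by moving
  eigenvalues one at a time. An eigenvector of A is an approximate eigenvector of M(c) as c tends
  to 0, which excludes eigenvalues in the open right half plane.
\<close>

section \<open>Products of shifted matrices\<close>

text \<open>Factored polynomials take the place of matrix exponentials, Jordan forms and Kronecker
  products: one factor M - s turns a coupled system into scalar equations, and the same device
  serves for A, for the Laplacian and for the closed loop. Scale-freeness rests on the exchange of
  Ch. It makes the coupling in D' = A D - L D an identity coupling, so the modes are governed by a -
  s with a an eigenvalue of A and s a nonzero eigenvalue of L. Only the sign of Re s matters, and no
  lower bound on it over all graphs is available. The obstacle in the necessity direction is that
  synchronization controls the agent states alone. M(c) may keep unstable protocol modes that never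
  reach the agent state, so it need not be Hurwitz, and P p(M(c)) = 0 is what remains. At c = 0 the
  two-node graph has no spanning tree, so nothing is known there directly, and the stable roots for
  c > 0 may approach the imaginary axis. An eigenvalue with positive real part keeps a fixed
  distance from all of them. With a single input, feedback is a rank-one update, so pole shifting
  needs no canonical form.\<close>

definition apply_mat :: "nat \<Rightarrow> (nat \<Rightarrow> nat \<Rightarrow> complex) \<Rightarrow> (nat \<Rightarrow> complex) \<Rightarrow> nat \<Rightarrow> complex" where
  "apply_mat n M v i = (\<Sum>j<n. M i j * v j)"

definition shift_apply :: "nat \<Rightarrow> (nat \<Rightarrow> nat \<Rightarrow> complex) \<Rightarrow> complex \<Rightarrow> (nat \<Rightarrow> complex) \<Rightarrow> nat \<Rightarrow> complex" where
  "shift_apply n M s v i = apply_mat n M v i - s * v i"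

abbreviation shifts_apply ::
    "nat \<Rightarrow> (nat \<Rightarrow> nat \<Rightarrow> complex) \<Rightarrow> complex list \<Rightarrow> (nat \<Rightarrow> complex) \<Rightarrow> nat \<Rightarrow> complex" where
  "shifts_apply n M ss v \<equiv> foldr (shift_apply n M) ss v"

text \<open>A list of roots stands for a polynomial, so that factors can be peeled off by list
  induction. Vectors are functions on \<open>nat\<close>, so that limits and derivatives are taken
  coordinate by coordinate. Coordinates from n on carry arbitrary values and are never read, hence
  the bound on i.\<close>

definition annihilated_by :: "nat \<Rightarrow> (nat \<Rightarrow> nat \<Rightarrow> complex) \<Rightarrow> complex list \<Rightarrow> bool" where
  "annihilated_by n M ss \<longleftrightarrow> (\<forall>v. \<forall>i<n. shifts_apply n M ss v i = 0)"

abbreviation entries :: "'a mat \<Rightarrow> nat \<Rightarrow> nat \<Rightarrow> 'a" where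
  "entries A i j \<equiv> A $$ (i, j)"

lemma apply_mat_cong: "(\<And>j. j < n \<Longrightarrow> v j = w j) \<Longrightarrow> apply_mat n M v i = apply_mat n M w i"
  unfolding apply_mat_def by (intro sum.cong) auto

lemma shifts_apply_mat_cong:
  assumes "\<And>i j. i < n \<Longrightarrow> j < n \<Longrightarrow> M i j = M' i j" "i < n"
  shows "shifts_apply n M ss v i = shifts_apply n M' ss v i"
  using assms(2)
proof (induction ss arbitrary: i)
  case (Cons s ss)
  have "apply_mat n M (shifts_apply n M ss v) i = apply_mat n M' (shifts_apply n M' ss v) i"
    unfolding apply_mat_def using Cons assms(1) by (intro sum.cong) auto
  then show ?case using Cons by (simp add: shift_apply_def[of _ _ s])
qed simp

lemma annihilated_by_cong:
  assumes "\<And>i j. i < n \<Longrightarrow> j < n \<Longrightarrow> M i j = M' i j" "annihilated_by n M ss"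
  shows "annihilated_by n M' ss"
  using assms shifts_apply_mat_cong[OF assms(1)] by (simp add: annihilated_by_def)

lemma apply_mat_plus: "apply_mat n (\<lambda>i j. M i j + M' i j) v i = apply_mat n M v i + apply_mat n M' v i"
  by (simp add: apply_mat_def algebra_simps sum.distrib)

lemma apply_mat_add: "apply_mat n M (\<lambda>i. v i + w i) i = apply_mat n M v i + apply_mat n M w i"
  by (simp add: apply_mat_def algebra_simps sum.distrib)

lemma apply_mat_diff: "apply_mat n M (\<lambda>i. v i - w i) i = apply_mat n M v i - apply_mat n M w i"
  by (simp add: apply_mat_def algebra_simps sum_subtractf)

lemma apply_mat_cmult: "apply_mat n M (\<lambda>i. c * v i) i = c * apply_mat n M v i"
  by (simp add: apply_mat_def sum_distrib_left mult_ac)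

lemma apply_mat_shift_apply:
  "apply_mat n M (shift_apply n M s v) = shift_apply n M s (apply_mat n M v)"
  by (rule ext) (simp add: shift_apply_def[abs_def] apply_mat_diff apply_mat_cmult)

lemma shift_apply_commute:
  "shift_apply n M s (shift_apply n M r v) = shift_apply n M r (shift_apply n M s v)"
  by (rule ext) (simp add: shift_apply_def[abs_def] apply_mat_diff apply_mat_cmult algebra_simps)

lemma shifts_apply_shift:
  "shifts_apply n M ss (shift_apply n M s v) = shift_apply n M s (shifts_apply n M ss v)"
  by (induction ss) (simp_all add: shift_apply_commute)

lemma shifts_apply_apply_mat:
  "shifts_apply n M ss (apply_mat n M v) = apply_mat n M (shifts_apply n M ss v)"
  by (induction ss) (simp_all add: apply_mat_shift_apply)

text \<open>From Q A = T Q follows Q p(A) = p(T) Q = 0, and the left inverse P cancels Q. Similar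
  matrices are the intended case.\<close>

lemma annihilated_by_intertwined:
  assumes T: "annihilated_by n T ss"
    and QA: "\<And>i v. i < n \<Longrightarrow> apply_mat n Q (apply_mat n A v) i = apply_mat n T (apply_mat n Q v) i"
    and PQ: "\<And>i v. i < n \<Longrightarrow> apply_mat n P (apply_mat n Q v) i = v i"
  shows "annihilated_by n A ss"
proof -
  have *: "apply_mat n Q (shifts_apply n A ss v) i = shifts_apply n T ss (apply_mat n Q v) i"
    if "i < n" for v i
    using that
  proof (induction ss arbitrary: i)
    case (Cons s ss)
    then show ?case
      by (simp add: shift_apply_def[abs_def] apply_mat_diff apply_mat_cmult QA cong: apply_mat_cong)
  qed simp
  show ?thesis
    unfolding annihilated_by_def
  proof (intro allI impI)
    fix v i assume "i < n"
    have "shifts_apply n A ss v i = apply_mat n P (apply_mat n Q (shifts_apply n A ss v)) i"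
      using PQ \<open>i < n\<close> by simp
    also have "\<dots> = apply_mat n P (\<lambda>_. 0) i"
      using T by (intro apply_mat_cong) (simp add: * annihilated_by_def)
    finally show "shifts_apply n A ss v i = 0" by (simp add: apply_mat_def)
  qed
qed

text \<open>\<open>foldr\<close> applies the last root first, in step with the last diagonal entry:
  each factor kills one more coordinate, counted from the bottom, and triangularity keeps the
  coordinates below it at zero.\<close>

lemma annihilated_by_upper_triangular:
  assumes T: "\<And>i j. j < i \<Longrightarrow> i < n \<Longrightarrow> T i j = 0"
    and len: "length ss = n" and diag: "\<And>i. i < n \<Longrightarrow> T i i = ss ! i"
  shows "annihilated_by n T ss"
  unfolding annihilated_by_def
proof (intro allI impI)
  fix v :: "nat \<Rightarrow> complex" and i assume "i < n"
  \<comment> \<open>Invariant: the last k factors annihilate the last k coordinates.\<close>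
  have "\<forall>i. n - k \<le> i \<and> i < n \<longrightarrow> shifts_apply n T (drop (n - k) ss) v i = 0" if "k \<le> n" for k
    using that
  proof (induction k)
    case (Suc k)
    define m where "m = n - Suc k"
    have m: "n - k = Suc m" "m < n" using Suc.prems by (auto simp: m_def)
    define w where "w = shifts_apply n T (drop (Suc m) ss) v"
    have w0: "w i = 0" if "Suc m \<le> i" "i < n" for i
      using Suc that unfolding m w_def by auto
    have d: "drop m ss = ss ! m # drop (Suc m) ss"
      using m len by (simp add: Cons_nth_drop_Suc)
    have "shift_apply n T (ss ! m) w i = 0" if i: "m \<le> i" "i < n" for i
    proof -
      have "apply_mat n T w i = (\<Sum>j\<in>{..<n}. if j = m then T i m * w m else 0)"
        unfolding apply_mat_def
      proof (rule sum.cong)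
        fix j assume j: "j \<in> {..<n}"
        show "T i j * w j = (if j = m then T i m * w m else 0)"
          using T[of j i] w0[of j] i j by (cases j m rule: linorder_cases) auto
      qed simp
      also have "\<dots> = T i m * w m" using m by simp
      finally show ?thesis
        using T[of m i] diag[of m] w0[of i] i m by (cases "i = m") (auto simp: shift_apply_def)
    qed
    then show ?case using d by (simp add: m_def[symmetric] w_def)
  qed auto
  from this[of n] show "shifts_apply n T ss v i = 0" using \<open>i < n\<close> by simp
qed

section \<open>Cayley-Hamilton through Schur triangularization\<close>

lemma index_mult_mat_vec_sum:
  assumes "A \<in> carrier_mat n m" "v \<in> carrier_vec m" "i < n"
  shows "(A *\<^sub>v v) $ i = (\<Sum>j<m. A $$ (i, j) * v $ j)"
  using assms by (auto simp: scalar_prod_def atLeast0LessThan intro!: sum.cong)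

lemma index_mult_mat_sum:
  assumes "A \<in> carrier_mat n m" "B \<in> carrier_mat m l" "i < n" "k < l"
  shows "(A * B) $$ (i, k) = (\<Sum>j<m. A $$ (i, j) * B $$ (j, k))"
  using assms by (auto simp: scalar_prod_def atLeast0LessThan intro!: sum.cong)

lemma apply_mat_mult:
  assumes "A \<in> carrier_mat n n" "B \<in> carrier_mat n n" "i < n"
  shows "apply_mat n (entries (A * B)) v i = apply_mat n (entries A) (apply_mat n (entries B) v) i"
proof -
  have "apply_mat n (entries (A * B)) v i = (\<Sum>k<n. \<Sum>j<n. A $$ (i, j) * B $$ (j, k) * v k)"
    unfolding apply_mat_def using assms
    by (intro sum.cong) (auto simp: index_mult_mat_sum[OF assms(1,2)] sum_distrib_right simp del: index_mult_mat)
  also have "\<dots> = apply_mat n (entries A) (apply_mat n (entries B) v) i"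
    unfolding apply_mat_def by (subst sum.swap) (simp add: sum_distrib_left mult_ac)
  finally show ?thesis .
qed

lemma apply_mat_one: "i < n \<Longrightarrow> apply_mat n (entries (1\<^sub>m n)) v i = v i"
  unfolding apply_mat_def by (simp add: if_distrib[of "\<lambda>x. x * _"] cong: if_cong)

text \<open>The Schur form carries the chosen list of eigenvalues on its diagonal in the given
  order, which is what the triangular case asks for. The length is recorded because the limit
  argument for small edge weights needs equally many factors for every weight.\<close>

theorem cayley_hamilton_shifts:
  assumes A: "A \<in> carrier_mat n n"
  obtains ss where "length ss = n" "\<And>s. s \<in> set ss \<Longrightarrow> eigenvalue A s"
    "annihilated_by n (entries A) ss"
proof -
  obtain ss where cp: "char_poly A = (\<Prod>a\<leftarrow>ss. [:- a, 1:])" and len: "length ss = n"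
    using char_poly_factorized[OF A] by auto
  obtain T P Q where sd: "schur_decomposition A ss = (T, P, Q)"
    by (cases "schur_decomposition A ss") auto
  from schur_decomposition[OF A cp sd]
  have sim: "similar_mat_wit A T P Q" and ut: "upper_triangular T" and dg: "diag_mat T = ss"
    by auto
  from similar_mat_witD2[OF A sim]
  have PQ: "P * Q = 1\<^sub>m n" and QP: "Q * P = 1\<^sub>m n" and APTQ: "A = P * T * Q"
    and T: "T \<in> carrier_mat n n" and P: "P \<in> carrier_mat n n" and Q: "Q \<in> carrier_mat n n"
    by auto
  have "Q * A = Q * (P * (T * Q))" using P T Q APTQ by (simp add: assoc_mult_mat[of _ n n])
  also have "\<dots> = (Q * P) * (T * Q)" using P T Q by (simp add: assoc_mult_mat[of _ n n _ n _ n])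
  finally have QA: "Q * A = T * Q" using T Q QP by simp
  have "annihilated_by n (entries T) ss"
  proof (rule annihilated_by_upper_triangular)
    show "T $$ (i, i) = ss ! i" if "i < n" for i
      using that T by (simp add: dg[symmetric] diag_mat_def)
  qed (use ut T len in auto)
  then have "annihilated_by n (entries A) ss"
  proof (rule annihilated_by_intertwined)
    fix i v assume "i < n"
    then show "apply_mat n (entries Q) (apply_mat n (entries A) v) i
        = apply_mat n (entries T) (apply_mat n (entries Q) v) i"
      using A Q T QA by (simp flip: apply_mat_mult)
    show "apply_mat n (entries P) (apply_mat n (entries Q) v) i = v i"
      using P Q PQ \<open>i < n\<close> by (simp add: apply_mat_one flip: apply_mat_mult)
  qed
  moreover have "eigenvalue A s" if "s \<in> set ss" for s
    using that by (auto simp: eigenvalue_root_char_poly[OF A] cp poly_prod_list prod_list_zero_iff)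
  ultimately show ?thesis using len that by blast
qed

lemma annihilated_by_eigenvalues_real:
  fixes A :: "real mat"
  assumes A: "A \<in> carrier_mat n n"
  obtains ss where "length ss = n" "\<And>s. s \<in> set ss \<Longrightarrow> eigenvalue (map_mat complex_of_real A) s"
    "annihilated_by n (\<lambda>i j. complex_of_real (A $$ (i, j))) ss"
proof -
  have A': "map_mat complex_of_real A \<in> carrier_mat n n" using A by simp
  obtain ss where "length ss = n" "\<And>s. s \<in> set ss \<Longrightarrow> eigenvalue (map_mat complex_of_real A) s"
    "annihilated_by n (entries (map_mat complex_of_real A)) ss"
    using cayley_hamilton_shifts[OF A'] by blast
  moreover from this(3) have "annihilated_by n (\<lambda>i j. complex_of_real (A $$ (i, j))) ss"
    by (rule annihilated_by_cong[rotated]) (use A in auto)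
  ultimately show ?thesis using that by blast
qed

section \<open>Linear differential equations\<close>

lemma has_vector_derivative_exp_linear:
  "((\<lambda>u. exp (c * complex_of_real u)) has_vector_derivative (c * exp (c * of_real t))) (at t within S)"
  by (rule has_vector_derivative_real_field) (auto intro!: derivative_eq_intros)

lemma has_vector_derivative_integrating_factor:
  fixes y :: "real \<Rightarrow> complex"
  assumes "(y has_vector_derivative (s * y t + f)) (at t within S)"
  shows "((\<lambda>u. exp (- s * of_real u) * y u) has_vector_derivative (exp (- s * of_real t) * f))
    (at t within S)"
  using has_vector_derivative_mult[OF has_vector_derivative_exp_linear[of "- s" t S] assms]
  by (simp add: algebra_simps)

text \<open>The integrating factor turns y into h with h' = exp(-s u) f. Once f is small, h grows at
  most like a small multiple of exp(r u), which the factor exp(-r t) outweighs when passing back to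
  y.\<close>

lemma scalar_ode_tendsto_zero:
  fixes y f :: "real \<Rightarrow> complex"
  assumes y: "\<And>t. t \<ge> 0 \<Longrightarrow> (y has_vector_derivative (s * y t + f t)) (at t within {0..})"
    and s: "Re s < 0" and f: "(f \<longlongrightarrow> 0) at_top"
  shows "(y \<longlongrightarrow> 0) at_top"
proof (rule tendstoI)
  fix e :: real assume e: "e > 0"
  \<comment> \<open>With decay rate r, a forcing bounded by d contributes at most d / r to the norm
    of y. The choice of d below makes this e / 2.\<close>
  define r where "r = - Re s"
  have r: "r > 0" using s by (simp add: r_def)
  define d where "d = e * r / 2"
  have d: "d > 0" using e r by (simp add: d_def)
  obtain T0 where T0: "\<And>t. t \<ge> T0 \<Longrightarrow> norm (f t) < d"
    using tendstoD[OF f d] by (auto simp: eventually_at_top_linorder)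
  define T where "T = max T0 0"
  have T: "T \<ge> 0" "\<And>t. t \<ge> T \<Longrightarrow> norm (f t) < d" using T0 by (auto simp: T_def)
  define h where "h u = exp (- s * of_real u) * y u" for u
  define p where "p u = d / r * exp (r * u)" for u :: real
  have h': "(h has_vector_derivative (exp (- s * of_real t) * f t)) (at t within {0..})" if "t \<ge> 0" for t
    unfolding h_def[abs_def] by (rule has_vector_derivative_integrating_factor[OF y[OF that]])
  have norm_y: "norm (y t) = exp (- r * t) * norm (h t)" for t
    by (simp add: h_def norm_mult norm_exp_eq_Re r_def flip: mult.assoc exp_add)
  have bound: "norm (y t) \<le> exp (- r * t) * norm (h T) + e / 2" if t: "t > T" for t
  proof -
    \<comment> \<open>Mean value inequality: p is the primitive of the bound d * exp (r * u) on the
      norm of the derivative of h.\<close>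
    have "norm (h t - h T) \<le> p t - p T"
    proof (rule differentiable_bound_general[OF t])
      show "continuous_on {T..t} h"
        by (rule continuous_on_vector_derivative[OF has_vector_derivative_within_subset[OF h']])
          (use T in auto)
      show "continuous_on {T..t} p" unfolding p_def by (intro continuous_intros)
      fix u assume u: "T < u" "u < t"
      then have "at u within {0..} = at u" using T by (intro at_within_interior) (auto simp: interior_real_atLeast)
      then show "(h has_vector_derivative (exp (- s * of_real u) * f u)) (at u)"
        using h'[of u] u T by auto
      show "(p has_vector_derivative (d * exp (r * u))) (at u)"
        unfolding p_def has_real_derivative_iff_has_vector_derivative[symmetric]
        using r by (auto intro!: derivative_eq_intros)
      show "norm (exp (- s * of_real u) * f u) \<le> d * exp (r * u)"
        using T(2)[of u] u by (simp add: norm_mult norm_exp_eq_Re r_def)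
    qed
    moreover have "p T \<ge> 0" using d r by (simp add: p_def)
    moreover have "norm (h t) \<le> norm (h T) + norm (h t - h T)"
      by (metis add.commute norm_triangle_sub)
    ultimately have "norm (h t) \<le> norm (h T) + p t" by linarith
    then have "norm (y t) \<le> exp (- r * t) * (norm (h T) + p t)"
      unfolding norm_y by (intro mult_left_mono) auto
    also have "\<dots> = exp (- r * t) * norm (h T) + e / 2"
      using r by (simp add: p_def d_def field_simps flip: exp_add)
    finally show ?thesis .
  qed
  have "((\<lambda>t. exp (- r * t) * norm (h T)) \<longlongrightarrow> 0) at_top"
  proof -
    have "filterlim (\<lambda>t. r * t) at_top at_top"
      using r by (intro filterlim_tendsto_pos_mult_at_top[OF tendsto_const]) (auto intro: filterlim_ident)
    then have "filterlim (\<lambda>t. - r * t) at_bot at_top"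
      by (simp add: filterlim_uminus_at_bot)
    from filterlim_compose[OF exp_at_bot this] show ?thesis
      by (rule tendsto_mult_left_zero)
  qed
  then have "eventually (\<lambda>t. exp (- r * t) * norm (h T) < e / 2) at_top"
    using order_tendstoD(2) e by (metis half_gt_zero)
  then show "eventually (\<lambda>t. dist (y t) 0 < e) at_top"
    using eventually_gt_at_top[of T]
  proof eventually_elim
    case (elim t)
    then show ?case using bound[of t] by (simp add: dist_norm)
  qed
qed

text \<open>exp(-s t) y(t) is constant, so the norm of y never falls below its initial value. The
  conclusion at time 0 suffices, since it is applied with arbitrary initial values.\<close>

lemma scalar_ode_unstable_zero:
  fixes y :: "real \<Rightarrow> complex"
  assumes y: "\<And>t. t \<ge> 0 \<Longrightarrow> (y has_vector_derivative (s * y t)) (at t within {0..})"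
    and s: "Re s \<ge> 0" and lim: "(y \<longlongrightarrow> 0) at_top"
  shows "y 0 = 0"
proof -
  have "((\<lambda>u. exp (- s * of_real u) * y u) has_vector_derivative 0) (at t within {0..})" if "t \<in> {0..}" for t
    using has_vector_derivative_integrating_factor[of y s t 0] y[of t] that by simp
  from has_vector_derivative_zero_constant[OF _ this]
  obtain c where c: "\<And>t. t \<ge> 0 \<Longrightarrow> exp (- s * of_real t) * y t = c"
    by (auto simp: convex_real_interval)
  have "norm (y 0) \<le> norm (y t)" if "t \<ge> 0" for t
  proof -
    have "norm (y 0) = exp (- Re s * t) * norm (y t)"
      using c[of 0] by (simp add: norm_mult norm_exp_eq_Re flip: c[OF that])
    also have "\<dots> \<le> 1 * norm (y t)"
      using s that by (intro mult_right_mono) auto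
    finally show ?thesis by simp
  qed
  then have "eventually (\<lambda>t. norm (y 0) \<le> norm (y t)) at_top"
    by (auto simp: eventually_at_top_linorder)
  from tendsto_lowerbound[OF tendsto_norm[OF lim] this] have "norm (y 0) \<le> 0"
    by simp
  then show ?thesis by simp
qed

definition solves_linear_ode ::
    "nat \<Rightarrow> (nat \<Rightarrow> nat \<Rightarrow> complex) \<Rightarrow> (nat \<Rightarrow> real \<Rightarrow> complex) \<Rightarrow> (nat \<Rightarrow> real \<Rightarrow> complex) \<Rightarrow> bool" where
  "solves_linear_ode n A g X \<longleftrightarrow> (\<forall>i<n. \<forall>t\<ge>0.
     (X i has_vector_derivative (apply_mat n A (\<lambda>j. X j t) i + g i t)) (at t within {0..}))"

lemma has_vector_derivative_apply_mat:
  assumes "\<And>j. j < n \<Longrightarrow> (X j has_vector_derivative D j) F"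
  shows "((\<lambda>t. apply_mat n M (\<lambda>j. X j t) i) has_vector_derivative apply_mat n M D i) F"
  unfolding apply_mat_def using assms
  by (auto intro!: has_vector_derivative_sum has_vector_derivative_mult_right)

lemma tendsto_apply_mat:
  assumes "\<And>j. j < n \<Longrightarrow> (X j \<longlongrightarrow> D j) F"
  shows "((\<lambda>t. apply_mat n M (\<lambda>j. X j t) i) \<longlongrightarrow> apply_mat n M D i) F"
  unfolding apply_mat_def using assms by (auto intro!: tendsto_intros)

lemma tendsto_shift_apply_zero:
  assumes "\<And>j. j < n \<Longrightarrow> (X j \<longlongrightarrow> 0) F" "i < n"
  shows "((\<lambda>t. shift_apply n M s (\<lambda>j. X j t) i) \<longlongrightarrow> 0) F"
  unfolding shift_apply_def
  using tendsto_diff[OF tendsto_apply_mat[OF assms(1)] tendsto_mult_right_zero[OF assms(1)[OF assms(2)]]]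
  by (simp add: apply_mat_def)

lemma solves_linear_ode_shift:
  assumes "solves_linear_ode n A g X"
  shows "solves_linear_ode n A (\<lambda>i t. shift_apply n A s (\<lambda>j. g j t) i) (\<lambda>i t. shift_apply n A s (\<lambda>j. X j t) i)"
  unfolding solves_linear_ode_def
proof (intro allI impI)
  fix i and t :: real assume i: "i < n" and t: "t \<ge> 0"
  let ?D = "\<lambda>j. apply_mat n A (\<lambda>j. X j t) j + g j t"
  have D: "(X j has_vector_derivative ?D j) (at t within {0..})" if "j < n" for j
    using assms that t by (simp add: solves_linear_ode_def)
  have eq: "shift_apply n A s ?D i = apply_mat n A (\<lambda>j. shift_apply n A s (\<lambda>j. X j t) j) i
      + shift_apply n A s (\<lambda>j. g j t) i"
    by (simp add: shift_apply_def apply_mat_add apply_mat_diff apply_mat_cmult algebra_simps)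
  show "((\<lambda>t. shift_apply n A s (\<lambda>j. X j t) i) has_vector_derivative
        apply_mat n A (\<lambda>j. shift_apply n A s (\<lambda>j. X j t) j) i + shift_apply n A s (\<lambda>j. g j t) i)
        (at t within {0..})"
    unfolding eq[symmetric] unfolding shift_apply_def
    by (intro has_vector_derivative_diff has_vector_derivative_apply_mat has_vector_derivative_mult_right D i)
qed

lemma solves_linear_ode_shifts:
  assumes "solves_linear_ode n A (\<lambda>_ _. 0) X"
  shows "solves_linear_ode n A (\<lambda>_ _. 0) (\<lambda>i t. shifts_apply n A ss (\<lambda>j. X j t) i)"
proof (induction ss)
  case (Cons s ss)
  from solves_linear_ode_shift[OF this, of s] show ?case
    by (simp add: shift_apply_def apply_mat_def)
qed (use assms in auto)

text \<open>With X1 = (A - s) X one has X' = s X + X1 + g, so decay propagates from X1 to X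
  along a factorization of an annihilating polynomial.\<close>

lemma linear_ode_tendsto_zero_if_shifts:
  assumes "solves_linear_ode n A g X" "\<And>i. i < n \<Longrightarrow> (g i \<longlongrightarrow> 0) at_top"
    and "\<And>s. s \<in> set ss \<Longrightarrow> Re s < 0"
    and "\<And>i. i < n \<Longrightarrow> ((\<lambda>t. shifts_apply n A ss (\<lambda>j. X j t) i) \<longlongrightarrow> 0) at_top"
    and "i < n"
  shows "(X i \<longlongrightarrow> 0) at_top"
  using assms
proof (induction ss arbitrary: X g i)
  case (Cons s ss)
  let ?X = "\<lambda>i t. shift_apply n A s (\<lambda>j. X j t) i"
  have X1: "(?X i \<longlongrightarrow> 0) at_top" if "i < n" for i
  proof (rule Cons.IH[OF solves_linear_ode_shift[OF Cons.prems(1)]])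
    show "((\<lambda>t. shift_apply n A s (\<lambda>j. g j t) i) \<longlongrightarrow> 0) at_top" if "i < n" for i
      using Cons.prems(2) that by (rule tendsto_shift_apply_zero)
    show "((\<lambda>t. shifts_apply n A ss (\<lambda>j. ?X j t) i) \<longlongrightarrow> 0) at_top" if "i < n" for i
      using Cons.prems(4)[OF that] by (simp add: shifts_apply_shift)
  qed (use Cons.prems that in auto)
  show ?case
  proof (rule scalar_ode_tendsto_zero[of _ s "\<lambda>t. ?X i t + g i t"])
    show "(X i has_vector_derivative s * X i t + (?X i t + g i t)) (at t within {0..})" if "t \<ge> 0" for t
      using Cons.prems(1,5) that by (simp add: solves_linear_ode_def shift_apply_def algebra_simps)
    show "((\<lambda>t. ?X i t + g i t) \<longlongrightarrow> 0) at_top"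
      using tendsto_add[OF X1 Cons.prems(2)] Cons.prems(5) by simp
  qed (use Cons.prems in auto)
qed simp

lemma linear_ode_tendsto_zero:
  assumes "solves_linear_ode n A g X" "\<And>i. i < n \<Longrightarrow> (g i \<longlongrightarrow> 0) at_top"
    and "annihilated_by n A ss" "\<And>s. s \<in> set ss \<Longrightarrow> Re s < 0" "i < n"
  shows "(X i \<longlongrightarrow> 0) at_top"
proof (rule linear_ode_tendsto_zero_if_shifts[OF assms(1,2,4)])
  show "((\<lambda>t. shifts_apply n A ss (\<lambda>j. X j t) i) \<longlongrightarrow> 0) at_top" if "i < n" for i
    using assms(3) that by (simp add: annihilated_by_def)
qed (use assms in auto)

text \<open>The solution exp(A t) v is built coordinatewise as an entire power series with
  coefficients (A^k v)_i / k!, so that termwise differentiation of complex power series yields the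
  equation.\<close>

lemma linear_ode_exists:
  obtains X where "solves_linear_ode n A (\<lambda>_ _. 0) X" "\<And>i. X i 0 = v i"
proof -
  define w where "w k = (apply_mat n A ^^ k) v" for k
  define c where "c i k = w k i / fact k" for i k
  have w: "w (Suc k) i = apply_mat n A (w k) i" for k i by (simp add: w_def)
  define K where "K = (\<Sum>i<n. \<Sum>j<n. norm (A i j))"
  define S where "S = (\<Sum>i<n. norm (v i))"
  have K0: "K \<ge> 0" "S \<ge> 0" by (auto simp: K_def S_def intro!: sum_nonneg)
  have apply_bound: "norm (apply_mat n A u i) \<le> (\<Sum>j<n. norm (A i j)) * (\<Sum>j<n. norm (u j))" for u i
  proof -
    have "norm (apply_mat n A u i) \<le> (\<Sum>j<n. norm (A i j) * norm (u j))"
      unfolding apply_mat_def by (rule order_trans[OF norm_sum]) (simp add: norm_mult)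
    also have "\<dots> \<le> (\<Sum>j<n. norm (A i j) * (\<Sum>j<n. norm (u j)))"
      by (intro sum_mono mult_left_mono member_le_sum) auto
    finally show ?thesis by (simp add: sum_distrib_right)
  qed
  have w_sum: "(\<Sum>i<n. norm (w k i)) \<le> K ^ k * S" for k
  proof (induction k)
    case (Suc k)
    have "(\<Sum>i<n. norm (w (Suc k) i)) \<le> (\<Sum>i<n. (\<Sum>j<n. norm (A i j)) * (\<Sum>j<n. norm (w k j)))"
      unfolding w by (intro sum_mono apply_bound)
    also have "\<dots> = K * (\<Sum>j<n. norm (w k j))" by (simp add: K_def sum_distrib_right)
    also have "\<dots> \<le> K * (K ^ k * S)" using Suc K0 by (intro mult_left_mono)
    finally show ?case by simp
  qed (simp add: w_def S_def)
  have summ: "summable (\<lambda>k. c i k * y ^ k)" if "i < n" for i and y :: complex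
  proof (rule summable_comparison_test')
    show "summable (\<lambda>k. S * ((K * norm y) ^ k / fact k))"
      using summable_exp[of "K * norm y"] by (intro summable_mult) (simp add: field_simps)
    fix k
    have "norm (w k i) \<le> (\<Sum>i<n. norm (w k i))" using that by (intro member_le_sum) auto
    also have "\<dots> \<le> K ^ k * S" by (rule w_sum)
    finally have "norm (w k i) * norm y ^ k / fact k \<le> K ^ k * S * norm y ^ k / fact k"
      by (intro divide_right_mono mult_right_mono) auto
    then show "norm (c i k * y ^ k) \<le> S * ((K * norm y) ^ k / fact k)"
      by (simp add: c_def norm_mult norm_divide norm_power power_mult_distrib mult_ac)
  qed
  \<comment> \<open>The default v i for the remaining coordinates makes the initial value equal to v
    at every index, so that it can be substituted as a function inside operator products.\<close>
  define Z where "Z i z = (if i < n then \<Sum>k. c i k * z ^ k else v i)" for i and z :: complex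
  have diffs_c: "diffs (c i) k = (\<Sum>j<n. A i j * c j k)" for i k
  proof -
    have "diffs (c i) k = w (Suc k) i / fact k"
      by (simp add: diffs_def c_def field_simps del: of_nat_Suc)
    also have "\<dots> = (\<Sum>j<n. A i j * c j k)"
      by (simp add: w apply_mat_def c_def sum_divide_distrib)
    finally show ?thesis .
  qed
  have deriv: "(Z i has_field_derivative apply_mat n A (\<lambda>j. Z j z) i) (at z)" if "i < n" for i z
  proof -
    have "(\<Sum>k. diffs (c i) k * z ^ k) = (\<Sum>k. \<Sum>j<n. A i j * (c j k * z ^ k))"
      by (simp add: diffs_c sum_distrib_left sum_distrib_right mult_ac)
    also have "\<dots> = (\<Sum>j<n. \<Sum>k. A i j * (c j k * z ^ k))"
      by (rule suminf_sum) (auto intro!: summable_mult summ)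
    also have "\<dots> = apply_mat n A (\<lambda>j. Z j z) i"
      unfolding apply_mat_def by (intro sum.cong) (auto simp: Z_def suminf_mult summ)
    finally show ?thesis
      using termdiffs_strong_converges_everywhere[OF summ[OF that], of z] that by (simp add: Z_def[abs_def])
  qed
  show ?thesis
  proof
    show "solves_linear_ode n A (\<lambda>_ _. 0) (\<lambda>i t. Z i (of_real t))"
      unfolding solves_linear_ode_def
      by (auto intro!: has_vector_derivative_real_field deriv)
    show "Z i (of_real 0) = v i" for i
      using powser_zero[of "c i"] by (simp add: Z_def c_def w_def)
  qed
qed

text \<open>If P q(M) (M - s) = 0 with Re s \<ge> 0, where P restricts to the first n coordinates, then
  y = P q(M) X satisfies y' = s y along every solution X; as y tends to zero it vanishes, so the
  factor M - s can be dropped. It is replaced by M + 1 only to keep the number of factors.\<close>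

lemma stable_shifts_exist:
  assumes stable: "\<And>X i. solves_linear_ode d M (\<lambda>_ _. 0) X \<Longrightarrow> i < n \<Longrightarrow> (X i \<longlongrightarrow> 0) at_top"
    and nd: "n \<le> d" and ann: "annihilated_by d M ss"
  obtains hs where "length hs = length ss" "\<And>s. s \<in> set hs \<Longrightarrow> Re s < 0"
    "\<And>v i. i < n \<Longrightarrow> shifts_apply d M hs v i = 0"
proof -
  \<comment> \<open>\<open>gs\<close> holds the factors already made stable and \<open>rs\<close>
    those still to be treated. The last factor of \<open>rs\<close> acts on v first, and since all
    factors commute it can be moved to the front.\<close>
  have "\<exists>hs. length hs = length gs + length rs \<and> (\<forall>s\<in>set hs. Re s < 0)
      \<and> (\<forall>v. \<forall>i<n. shifts_apply d M hs v i = 0)"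
    if "\<forall>s\<in>set gs. Re s < 0" "\<forall>v. \<forall>i<n. shifts_apply d M (gs @ rs) v i = 0" for gs rs
    using that
  proof (induction rs arbitrary: gs rule: rev_induct)
    case (snoc s rs)
    let ?Q = "shifts_apply d M (gs @ rs)"
    have Qs: "?Q (shift_apply d M s v) i = 0" if "i < n" for v i
      using snoc.prems(2) that by simp
    show ?case
    proof (cases "Re s < 0")
      case True
      have "shifts_apply d M ((s # gs) @ rs) v i = 0" if "i < n" for v i
        using Qs[OF that, of v] by (simp only: shifts_apply_shift) simp
      then show ?thesis
        using snoc.IH[of "s # gs"] snoc.prems(1) True by auto
    next
      case False
      have Q0: "?Q v i = 0" if i: "i < n" for v i
      proof -
        obtain X where X: "solves_linear_ode d M (\<lambda>_ _. 0) X" and X0: "\<And>i. X i 0 = v i"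
          using linear_ode_exists by blast
        let ?Y = "\<lambda>i t. ?Q (\<lambda>j. X j t) i"
        have Y: "solves_linear_ode d M (\<lambda>_ _. 0) ?Y" by (rule solves_linear_ode_shifts[OF X])
        have "?Y i 0 = 0"
        proof (rule scalar_ode_unstable_zero[of _ s])
          fix t :: real assume "t \<ge> 0"
          moreover have "apply_mat d M (\<lambda>j. ?Y j t) i = s * ?Y i t"
            using Qs[OF i, of "\<lambda>j. X j t"] by (simp only: shifts_apply_shift) (simp add: shift_apply_def)
          ultimately show "(?Y i has_vector_derivative s * ?Y i t) (at t within {0..})"
            using Y[unfolded solves_linear_ode_def, rule_format, of i t] i nd by simp
        qed (use False stable[OF Y i] in auto)
        then show ?thesis by (simp add: X0)
      qed
      have "shifts_apply d M (((-1) # gs) @ rs) v i = 0" if "i < n" for v i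
        using Q0[OF that, of "shift_apply d M (-1) v"] by (simp only: shifts_apply_shift) simp
      then show ?thesis
        using snoc.IH[of "(-1) # gs"] snoc.prems(1) by auto
    qed
  qed auto
  from this[of "[]" ss] ann nd that show ?thesis by (auto simp: annihilated_by_def)
qed

section \<open>Laplacians and consensus\<close>

lemma laplacian_mult:
  fixes v :: "nat \<Rightarrow> 'a::{real_algebra_1,comm_ring_1}"
  assumes "is_weighted_digraph N a" "i < N"
  shows "(\<Sum>j<N. of_real (laplacian N a i j) * v j) = (\<Sum>j<N. of_real (a i j) * (v i - v j))"
proof -
  have "of_real (laplacian N a i j) * v j
      = (if j = i then (\<Sum>k<N. of_real (a i k)) * v i else 0) - of_real (a i j) * v j" for j
    using assms by (auto simp: laplacian_def is_weighted_digraph_def)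
  then have "(\<Sum>j<N. of_real (laplacian N a i j) * v j)
      = (\<Sum>j<N. (if j = i then (\<Sum>k<N. of_real (a i k)) * v i else 0) - of_real (a i j) * v j)"
    by simp
  then show ?thesis
    using assms(2) by (simp add: sum_subtractf sum_distrib_right right_diff_distrib)
qed

text \<open>Maximum principle: at a node where v is maximal, all summands are nonnegative and add up
  to zero, so every in-neighbour is maximal too. Following a path from the root backwards carries
  maximality to the root.\<close>

lemma laplacian_kernel_le_root:
  fixes v :: "nat \<Rightarrow> real"
  assumes a: "is_weighted_digraph N a" and root: "\<And>i. i < N \<Longrightarrow> (dedge N a)\<^sup>*\<^sup>* r i"
    and ker: "\<And>i. i < N \<Longrightarrow> (\<Sum>j<N. a i j * (v i - v j)) = 0" and i: "i < N"
  shows "v i \<le> v r"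
proof -
  let ?m = "Max (v ` {..<N})"
  have le: "v j \<le> ?m" if "j < N" for j using that by (intro Max_ge) auto
  have "?m \<in> v ` {..<N}" using i by (intro Max_in) auto
  then obtain i0 where i0: "i0 < N" "v i0 = ?m" by auto
  from root[OF i0(1)] have "v r = ?m"
  proof (induction rule: converse_rtranclp_induct)
    case (step j k)
    then have jk: "j < N" "k < N" "a k j > 0" by (auto simp: dedge_def)
    have "\<forall>j\<in>{..<N}. a k j * (v k - v j) = 0"
      using ker[OF jk(2)] a le jk step
      by (subst (asm) sum_nonneg_eq_0_iff) (auto simp: is_weighted_digraph_def)
    then have "a k j * (v k - v j) = 0" using jk by blast
    then show ?case using jk step by simp
  qed (use i0 in auto)
  then show ?thesis using le[OF i] by simp
qed

lemma laplacian_kernel_const_real: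
  fixes v :: "nat \<Rightarrow> real"
  assumes a: "is_weighted_digraph N a" and tree: "has_directed_spanning_tree N a"
    and ker: "\<And>i. i < N \<Longrightarrow> (\<Sum>j<N. a i j * (v i - v j)) = 0" and ij: "i < N" "j < N"
  shows "v i = v j"
proof -
  obtain r where r: "\<And>i. i < N \<Longrightarrow> (dedge N a)\<^sup>*\<^sup>* r i"
    using tree by (auto simp: has_directed_spanning_tree_def)
  have "(\<Sum>j<N. a i j * (- v i - - v j)) = 0" if "i < N" for i
    using ker[OF that] by (simp add: algebra_simps sum_subtractf)
  from laplacian_kernel_le_root[OF a r ker] laplacian_kernel_le_root[OF a r this]
  have "v k = v r" if "k < N" for k using that by (intro antisym) auto
  then show ?thesis using ij by metis
qed

text \<open>L v is nonnegative at a maximum of v and nonpositive at a minimum, so the only constant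
  vector in the image of L is zero.\<close>

lemma laplacian_image_const_real:
  fixes v :: "nat \<Rightarrow> real"
  assumes a: "is_weighted_digraph N a" and N: "N > 0"
    and im: "\<And>i. i < N \<Longrightarrow> (\<Sum>j<N. a i j * (v i - v j)) = c"
  shows "c = 0"
proof (rule antisym)
  have fin: "finite (v ` {..<N})" "v ` {..<N} \<noteq> {}" using N by auto
  obtain i where i: "i < N" "v i = Max (v ` {..<N})" using Max_in[OF fin] by auto
  have "v j \<le> v i" if "j < N" for j using that unfolding i by (intro Max_ge) auto
  then have "0 \<le> (\<Sum>j<N. a i j * (v i - v j))"
    using a i by (intro sum_nonneg) (auto simp: is_weighted_digraph_def)
  then show "0 \<le> c" by (simp only: im[OF i(1)])
  obtain k where k: "k < N" "v k = Min (v ` {..<N})" using Min_in[OF fin] by auto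
  have "v k \<le> v j" if "j < N" for j using that unfolding k by (intro Min_le) auto
  then have "(\<Sum>j<N. a k j * (v k - v j)) \<le> 0"
    using a k by (intro sum_nonpos) (auto simp: is_weighted_digraph_def mult_le_0_iff)
  then show "c \<le> 0" by (simp only: im[OF k(1)])
qed

abbreviation complex_laplacian :: "nat \<Rightarrow> (nat \<Rightarrow> nat \<Rightarrow> real) \<Rightarrow> nat \<Rightarrow> nat \<Rightarrow> complex" where
  "complex_laplacian N a i j \<equiv> complex_of_real (laplacian N a i j)"

lemma apply_laplacian:
  assumes "is_weighted_digraph N a" "i < N"
  shows "apply_mat N (complex_laplacian N a) v i = (\<Sum>j<N. of_real (a i j) * (v i - v j))"
  unfolding apply_mat_def by (rule laplacian_mult[OF assms])

lemma laplacian_kernel_const: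
  assumes a: "is_weighted_digraph N a" and tree: "has_directed_spanning_tree N a"
    and ker: "\<And>i. i < N \<Longrightarrow> apply_mat N (complex_laplacian N a) v i = 0" and ij: "i < N" "j < N"
  shows "v i = v j"
proof -
  have z: "(\<Sum>j<N. of_real (a i j) * (v i - v j)) = 0" if "i < N" for i
    using ker[OF that] apply_laplacian[OF a that] by simp
  have "(\<Sum>j<N. a i j * (Re (v i) - Re (v j))) = 0" "(\<Sum>j<N. a i j * (Im (v i) - Im (v j))) = 0"
    if "i < N" for i
    using arg_cong[OF z[OF that], of Re] arg_cong[OF z[OF that], of Im] by auto
  from laplacian_kernel_const_real[OF a tree this(1) ij] laplacian_kernel_const_real[OF a tree this(2) ij]
  show ?thesis by (simp add: complex_eq_iff)
qed

text \<open>The eigenvalue 0 is semisimple: if L L v = 0, then L v lies in the kernel, hence is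
  constant, and a constant in the image vanishes. This allows repeated factors L to be merged into
  one.\<close>

lemma laplacian_kernel_square:
  assumes a: "is_weighted_digraph N a" and tree: "has_directed_spanning_tree N a"
    and ker: "\<And>i. i < N \<Longrightarrow>
      apply_mat N (complex_laplacian N a) (apply_mat N (complex_laplacian N a) v) i = 0"
    and i: "i < N"
  shows "apply_mat N (complex_laplacian N a) v i = 0"
proof -
  define c where "c = apply_mat N (complex_laplacian N a) v i"
  have c: "(\<Sum>j<N. of_real (a k j) * (v k - v j)) = c" if "k < N" for k
    using laplacian_kernel_const[OF a tree ker that i] apply_laplacian[OF a that, of v] by (simp add: c_def)
  have "(\<Sum>j<N. a k j * (Re (v k) - Re (v j))) = Re c" "(\<Sum>j<N. a k j * (Im (v k) - Im (v j))) = Im c"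
    if "k < N" for k
    using arg_cong[OF c[OF that], of Re] arg_cong[OF c[OF that], of Im] by auto
  from laplacian_image_const_real[OF a _ this(1)] laplacian_image_const_real[OF a _ this(2)] i
  have "c = 0" by (simp add: complex_eq_iff)
  then show ?thesis by (simp add: c_def)
qed

text \<open>Gershgorin's argument in the row where the eigenvector is largest: s lies in the disc of
  radius D around D, the degree of that row, and this disc meets the imaginary axis only at
  0.\<close>

lemma laplacian_eigenvalue:
  assumes a: "is_weighted_digraph N a"
    and ev: "eigenvalue (mat N N (\<lambda>(i, j). complex_laplacian N a i j)) s"
  shows "s = 0 \<or> Re s > 0"
proof -
  let ?L = "mat N N (\<lambda>(i, j). complex_laplacian N a i j)"
  obtain v where v: "v \<in> carrier_vec N" "v \<noteq> 0\<^sub>v N" and Lv: "?L *\<^sub>v v = s \<cdot>\<^sub>v v"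
    using ev by (auto simp: eigenvalue_def eigenvector_def)
  let ?f = "\<lambda>i. norm (v $ i)"
  obtain k where k: "k < N" "v $ k \<noteq> 0" using v by (metis carrier_vecD eq_vecI index_zero_vec)
  have fin: "finite (?f ` {..<N})" "?f ` {..<N} \<noteq> {}" using k by auto
  obtain i where i: "i < N" "?f i = Max (?f ` {..<N})" using Max_in[OF fin] by auto
  have le: "?f j \<le> ?f i" if "j < N" for j using that unfolding i by (intro Max_ge) auto
  have vi: "?f i > 0" using le[OF k(1)] k(2) by (smt (verit) zero_less_norm_iff)
  define D where "D = (\<Sum>j<N. a i j)"
  have D: "D \<ge> 0" using a i by (auto simp: D_def is_weighted_digraph_def intro!: sum_nonneg)
  have "(\<Sum>j<N. complex_laplacian N a i j * v $ j) = (?L *\<^sub>v v) $ i"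
    using v i by (subst index_mult_mat_vec_sum[of _ N N]) auto
  also have "\<dots> = s * v $ i" using v i by (simp add: Lv)
  finally have "(\<Sum>j<N. of_real (a i j) * (v $ i - v $ j)) = s * v $ i"
    using laplacian_mult[OF a i(1), of "\<lambda>j. v $ j"] by simp
  then have "(of_real D - s) * v $ i = (\<Sum>j<N. of_real (a i j) * v $ j)"
    by (simp add: D_def algebra_simps sum_subtractf sum_distrib_left)
  then have "norm (of_real D - s) * ?f i = norm (\<Sum>j<N. of_real (a i j) * v $ j)"
    by (metis norm_mult)
  also have "\<dots> \<le> (\<Sum>j<N. a i j * ?f i)"
    using a i le
    by (intro order_trans[OF norm_sum] sum_mono)
      (auto simp: norm_mult is_weighted_digraph_def intro!: mult_left_mono)
  also have "\<dots> = D * ?f i" by (simp add: D_def sum_distrib_right)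
  finally have "norm (of_real D - s) \<le> D" using vi by simp
  then have "(norm (of_real D - s))\<^sup>2 \<le> D\<^sup>2" by (intro power_mono) auto
  then have *: "(Re s)\<^sup>2 + (Im s)\<^sup>2 \<le> 2 * D * Re s"
    unfolding cmod_power2 by (simp add: power2_eq_square algebra_simps)
  show ?thesis
  proof (rule disjCI)
    assume "\<not> Re s > 0"
    then have "2 * D * Re s \<le> 0" using D by (auto simp: mult_le_0_iff)
    with * have "(Re s)\<^sup>2 + (Im s)\<^sup>2 \<le> 0" by linarith
    then show "s = 0" by (simp add: complex_eq_iff sum_power2_le_zero_iff)
  qed
qed

text \<open>Removing all zero roots from an annihilating product and keeping a single L in front
  gives L p(L) = 0. The values of p(L) then lie in the kernel of L, which a spanning tree makes the
  constants.\<close>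

lemma laplacian_shifts_const:
  assumes a: "is_weighted_digraph N a" and tree: "has_directed_spanning_tree N a"
  obtains ss where "\<And>s. s \<in> set ss \<Longrightarrow> Re s > 0"
    "\<And>v i j. i < N \<Longrightarrow> j < N \<Longrightarrow>
      shifts_apply N (complex_laplacian N a) ss v i = shifts_apply N (complex_laplacian N a) ss v j"
proof -
  let ?L = "complex_laplacian N a"
  let ?M = "mat N N (\<lambda>(i, j). ?L i j)"
  have M: "?M \<in> carrier_mat N N" by simp
  obtain ss where ev: "\<And>s. s \<in> set ss \<Longrightarrow> eigenvalue ?M s" and annM: "annihilated_by N (entries ?M) ss"
    using cayley_hamilton_shifts[OF M] by metis
  have ann: "annihilated_by N ?L ss"
    by (rule annihilated_by_cong[OF _ annM]) simp
  \<comment> \<open>One L always stays in front. A zero root in \<open>rs\<close> produces a second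
    L, which \<open>laplacian_kernel_square\<close> absorbs; all other roots move to
    \<open>gs\<close>.\<close>
  have reduce: "\<exists>hs. (\<forall>s\<in>set hs. Re s > 0) \<and> (\<forall>v. \<forall>i<N. apply_mat N ?L (shifts_apply N ?L hs v) i = 0)"
    if "\<forall>s\<in>set gs. Re s > 0" "\<forall>s\<in>set rs. s = 0 \<or> Re s > 0"
      "\<forall>v. \<forall>i<N. apply_mat N ?L (shifts_apply N ?L (gs @ rs) v) i = 0" for gs rs
    using that
  proof (induction rs arbitrary: gs)
    case (Cons s rs)
    show ?case
    proof (cases "s = 0")
      case True
      have "apply_mat N ?L (shifts_apply N ?L (gs @ rs) v) i = 0" if "i < N" for v i
      proof (rule laplacian_kernel_square[OF a tree _ that])
        fix i assume "i < N"
        have "apply_mat N ?L (shifts_apply N ?L gs (shift_apply N ?L s (shifts_apply N ?L rs v))) i = 0"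
          using Cons.prems(3) \<open>i < N\<close> by simp
        moreover have "shift_apply N ?L s w = apply_mat N ?L w" for w
          using True by (auto simp: shift_apply_def)
        ultimately show "apply_mat N ?L (apply_mat N ?L (shifts_apply N ?L (gs @ rs) v)) i = 0"
          by (simp add: shifts_apply_apply_mat)
      qed
      then show ?thesis using Cons.IH[of gs] Cons.prems by auto
    next
      case False
      then show ?thesis using Cons.IH[of "gs @ [s]"] Cons.prems by auto
    qed
  qed auto
  \<comment> \<open>Prefixing L to a vanishing product supplies the leading L even if 0 does not
    occur among the roots.\<close>
  have "apply_mat N ?L (shifts_apply N ?L ss v) i = 0" for v i
    using ann by (simp add: apply_mat_def annihilated_by_def)
  with reduce[of "[]" ss] laplacian_eigenvalue[OF a ev] obtain hs where "\<forall>s\<in>set hs. Re s > 0"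
    and ker: "\<And>v i. i < N \<Longrightarrow> apply_mat N ?L (shifts_apply N ?L hs v) i = 0"
    by auto
  then show ?thesis
    using that[of hs] laplacian_kernel_const[OF a tree ker] by blast
qed

section \<open>Consensus of disturbed agents coupled through the Laplacian\<close>

definition sub_scalar :: "(nat \<Rightarrow> nat \<Rightarrow> complex) \<Rightarrow> complex \<Rightarrow> nat \<Rightarrow> nat \<Rightarrow> complex" where
  "sub_scalar A s i j = A i j - (if i = j then s else 0)"

lemma apply_sub_scalar: "i < n \<Longrightarrow> apply_mat n (sub_scalar A s) v i = shift_apply n A s v i"
  by (simp add: apply_mat_def shift_apply_def sub_scalar_def algebra_simps sum_subtractf
      if_distrib[of "\<lambda>x. _ * x"] cong: if_cong)

lemma annihilated_by_sub_scalar: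
  assumes "annihilated_by n A as"
  shows "annihilated_by n (sub_scalar A s) (map (\<lambda>a. a - s) as)"
proof -
  have "shifts_apply n (sub_scalar A s) (map (\<lambda>a. a - s) as) v i = shifts_apply n A as v i"
    if "i < n" for v i
    using that
  proof (induction as arbitrary: i)
    case (Cons a as)
    then show ?case
      by (simp add: shift_apply_def apply_sub_scalar algebra_simps cong: apply_mat_cong)
  qed simp
  then show ?thesis using assms by (simp add: annihilated_by_def)
qed

text \<open>One factor L - s is undone at a time. With D1 = (L - s) D one has L D = s D + D1, so a
  difference of two agents in D obeys E' = (A - s) E plus differences of D1 and e. The first tend to
  zero by induction, and A - s is stable because Re s > 0 while A has no eigenvalue to the right of
  the axis.\<close>

lemma consensus_of_shifts:
  fixes D e :: "nat \<Rightarrow> nat \<Rightarrow> real \<Rightarrow> complex"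
  assumes D: "\<And>i k t. i < N \<Longrightarrow> k < n \<Longrightarrow> t \<ge> 0 \<Longrightarrow>
      (D i k has_vector_derivative
        (apply_mat n A (\<lambda>l. D i l t) k - apply_mat N L (\<lambda>j. D j k t) i + e i k t)) (at t within {0..})"
    and e: "\<And>i k. i < N \<Longrightarrow> k < n \<Longrightarrow> (e i k \<longlongrightarrow> 0) at_top"
    and A: "annihilated_by n A as" "\<And>s. s \<in> set as \<Longrightarrow> Re s \<le> 0"
    and ss: "\<And>s. s \<in> set ss \<Longrightarrow> Re s > 0"
    and lim: "\<And>i j k. i < N \<Longrightarrow> j < N \<Longrightarrow> k < n \<Longrightarrow>
      ((\<lambda>t. shifts_apply N L ss (\<lambda>j. D j k t) i - shifts_apply N L ss (\<lambda>j. D j k t) j) \<longlongrightarrow> 0) at_top"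
    and ijk: "i < N" "j < N" "k < n"
  shows "((\<lambda>t. D i k t - D j k t) \<longlongrightarrow> 0) at_top"
  using D e ss lim ijk
proof (induction ss arbitrary: D e i j k)
  case (Cons s ss)
  let ?D = "\<lambda>i k t. shift_apply N L s (\<lambda>j. D j k t) i"
  let ?e = "\<lambda>i k t. shift_apply N L s (\<lambda>j. e j k t) i"
  have D1: "((\<lambda>t. ?D i k t - ?D j k t) \<longlongrightarrow> 0) at_top" if "i < N" "j < N" "k < n" for i j k
  proof (rule Cons.IH[of ?D ?e])
    fix i k and t :: real assume *: "i < N" "k < n" "t \<ge> 0"
    let ?R = "\<lambda>j. apply_mat n A (\<lambda>l. D j l t) k - apply_mat N L (\<lambda>j. D j k t) j + e j k t"
    \<comment> \<open>A acts on state coordinates and L on agents, so the two commute and (L - s) D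
      solves an equation of the same form.\<close>
    have swap: "apply_mat N L (\<lambda>j. apply_mat n A (\<lambda>l. D j l t) k) i
        = apply_mat n A (\<lambda>l. apply_mat N L (\<lambda>j. D j l t) i) k"
      unfolding apply_mat_def sum_distrib_left by (subst sum.swap) (simp add: mult_ac)
    have "(?D i k has_vector_derivative shift_apply N L s ?R i) (at t within {0..})"
      unfolding shift_apply_def using * Cons.prems(1)
      by (intro has_vector_derivative_diff has_vector_derivative_apply_mat has_vector_derivative_mult_right) auto
    moreover have "shift_apply N L s ?R i
        = apply_mat n A (\<lambda>l. ?D i l t) k - apply_mat N L (\<lambda>j. ?D j k t) i + ?e i k t"
      by (simp add: shift_apply_def apply_mat_add apply_mat_diff apply_mat_cmult swap algebra_simps)
    ultimately show "(?D i k has_vector_derivative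
        apply_mat n A (\<lambda>l. ?D i l t) k - apply_mat N L (\<lambda>j. ?D j k t) i + ?e i k t) (at t within {0..})"
      by simp
  next
    show "(?e i k \<longlongrightarrow> 0) at_top" if "i < N" "k < n" for i k
      using Cons.prems(2) that by (intro tendsto_shift_apply_zero) auto
    show "((\<lambda>t. shifts_apply N L ss (\<lambda>j. ?D j k t) i - shifts_apply N L ss (\<lambda>j. ?D j k t) j) \<longlongrightarrow> 0) at_top"
      if "i < N" "j < N" "k < n" for i j k
      using Cons.prems(4)[OF that] by (simp add: shifts_apply_shift)
  qed (use Cons.prems that in auto)
  let ?E = "\<lambda>k t. D i k t - D j k t"
  let ?g = "\<lambda>k t. - (?D i k t - ?D j k t) + (e i k t - e j k t)"
  have "(?E k \<longlongrightarrow> 0) at_top"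
  proof (rule linear_ode_tendsto_zero[OF _ _ annihilated_by_sub_scalar[OF A(1)]])
    show "solves_linear_ode n (sub_scalar A s) ?g ?E"
      unfolding solves_linear_ode_def
    proof (intro allI impI)
      fix k and t :: real assume k: "k < n" and t: "t \<ge> 0"
      show "(?E k has_vector_derivative apply_mat n (sub_scalar A s) (\<lambda>k. ?E k t) k + ?g k t) (at t within {0..})"
        using has_vector_derivative_diff[OF Cons.prems(1)[OF Cons.prems(5) k t] Cons.prems(1)[OF Cons.prems(6) k t]]
        by (simp add: apply_sub_scalar[OF k] shift_apply_def apply_mat_diff algebra_simps)
    qed
    show "(?g k \<longlongrightarrow> 0) at_top" if "k < n" for k
      using tendsto_add[OF tendsto_minus[OF D1[OF Cons.prems(5,6) that]]
          tendsto_diff[OF Cons.prems(2)[OF Cons.prems(5) that] Cons.prems(2)[OF Cons.prems(6) that]]]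
      by simp
    show "Re x < 0" if "x \<in> set (map (\<lambda>a. a - s) as)" for x
      using that A(2) Cons.prems(3)[of s] by force
  qed (use Cons.prems in auto)
  then show ?case .
qed simp

section \<open>The protocol\<close>

text \<open>The observer error E = L X - Xh obeys E' = (A + KC) E, the deviation D = X - Ch obeys
  D' = A D - L D + E, and Ch' = (A + BF) Ch + L D - E. Hence E, the differences of D, and Ch
  tend to zero one after the other.\<close>

lemma protocol_synchronizes:
  fixes X Xh Ch :: "nat \<Rightarrow> nat \<Rightarrow> real \<Rightarrow> complex"
  assumes a: "is_weighted_digraph N a" and tree: "has_directed_spanning_tree N a"
    and L: "L = complex_laplacian N a"
    and A: "annihilated_by n A as" "\<And>s. s \<in> set as \<Longrightarrow> Re s \<le> 0"
    and AK: "annihilated_by n (\<lambda>i j. A i j + KC i j) ks" "\<And>s. s \<in> set ks \<Longrightarrow> Re s < 0"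
    and AF: "annihilated_by n (\<lambda>i j. A i j + BF i j) fs" "\<And>s. s \<in> set fs \<Longrightarrow> Re s < 0"
    and X: "\<And>i k t. i < N \<Longrightarrow> k < n \<Longrightarrow> t \<ge> 0 \<Longrightarrow> (X i k has_vector_derivative
      apply_mat n A (\<lambda>l. X i l t) k + apply_mat n BF (\<lambda>l. Ch i l t) k) (at t within {0..})"
    and Xh: "\<And>i k t. i < N \<Longrightarrow> k < n \<Longrightarrow> t \<ge> 0 \<Longrightarrow> (Xh i k has_vector_derivative
      apply_mat n A (\<lambda>l. Xh i l t) k + apply_mat n KC (\<lambda>l. Xh i l t) k
      - apply_mat n KC (\<lambda>l. apply_mat N L (\<lambda>j. X j l t) i) k
      + apply_mat n BF (\<lambda>l. apply_mat N L (\<lambda>j. Ch j l t) i) k) (at t within {0..})"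
    and Ch: "\<And>i k t. i < N \<Longrightarrow> k < n \<Longrightarrow> t \<ge> 0 \<Longrightarrow> (Ch i k has_vector_derivative
      Xh i k t + apply_mat n A (\<lambda>l. Ch i l t) k + apply_mat n BF (\<lambda>l. Ch i l t) k
      - apply_mat N L (\<lambda>j. Ch j k t) i) (at t within {0..})"
    and ijk: "i < N" "j < N" "k < n"
  shows "((\<lambda>t. X i k t - X j k t) \<longlongrightarrow> 0) at_top"
proof -
  have swap: "apply_mat N L (\<lambda>j. apply_mat n M (\<lambda>l. Y j l) k) i
      = apply_mat n M (\<lambda>l. apply_mat N L (\<lambda>j. Y j l) i) k" for M Y i k
    unfolding apply_mat_def sum_distrib_left by (subst sum.swap) (simp add: mult_ac)
  define E where "E i k t = apply_mat N L (\<lambda>j. X j k t) i - Xh i k t" for i k t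
  define D where "D i k t = X i k t - Ch i k t" for i k t
  have E: "(E i k \<longlongrightarrow> 0) at_top" if i: "i < N" and k: "k < n" for i k
  proof (rule linear_ode_tendsto_zero[OF _ _ AK(1)])
    show "solves_linear_ode n (\<lambda>i j. A i j + KC i j) (\<lambda>_ _. 0) (E i)"
      unfolding solves_linear_ode_def
    proof (intro allI impI)
      fix k and t :: real assume k: "k < n" and t: "t \<ge> 0"
      have "((\<lambda>t. apply_mat N L (\<lambda>j. X j k t) i) has_vector_derivative
          apply_mat N L (\<lambda>j. apply_mat n A (\<lambda>l. X j l t) k + apply_mat n BF (\<lambda>l. Ch j l t) k) i)
          (at t within {0..})"
        by (intro has_vector_derivative_apply_mat X k t)
      from has_vector_derivative_diff[OF this Xh[OF i k t]]
      show "(E i k has_vector_derivative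
          apply_mat n (\<lambda>i j. A i j + KC i j) (\<lambda>j. E i j t) k + 0) (at t within {0..})"
        by (simp add: E_def[abs_def] apply_mat_plus apply_mat_add apply_mat_diff swap algebra_simps)
    qed
  qed (use AK k in auto)
  obtain ss where ss: "\<And>s. s \<in> set ss \<Longrightarrow> Re s > 0"
    "\<And>v i j. i < N \<Longrightarrow> j < N \<Longrightarrow> shifts_apply N L ss v i = shifts_apply N L ss v j"
    using laplacian_shifts_const[OF a tree] unfolding L by blast
  have D: "((\<lambda>t. D i k t - D j k t) \<longlongrightarrow> 0) at_top" if "i < N" "j < N" "k < n" for i j k
  proof (rule consensus_of_shifts[OF _ E A ss(1)])
    show "(D i k has_vector_derivative
        apply_mat n A (\<lambda>l. D i l t) k - apply_mat N L (\<lambda>j. D j k t) i + E i k t) (at t within {0..})"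
      if "i < N" "k < n" "t \<ge> 0" for i k t
      using has_vector_derivative_diff[OF X[OF that] Ch[OF that]]
      by (simp add: D_def[abs_def] E_def apply_mat_diff algebra_simps)
    show "((\<lambda>t. shifts_apply N L ss (\<lambda>j. D j k t) i - shifts_apply N L ss (\<lambda>j. D j k t) j) \<longlongrightarrow> 0) at_top"
      if "i < N" "j < N" "k < n" for i j k
      using ss(2)[OF that(1,2)] by simp
  qed (use that in auto)
  \<comment> \<open>L annihilates constants, so L D is made of differences of D. D itself may fail
    to converge when A has eigenvalues on the imaginary axis.\<close>
  have LD: "((\<lambda>t. apply_mat N L (\<lambda>j. D j k t) i) \<longlongrightarrow> 0) at_top" if "i < N" "k < n" for i k
    unfolding L apply_laplacian[OF a that(1)] using that D
    by (intro tendsto_null_sum tendsto_mult_right_zero) auto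
  have Ch0: "(Ch i k \<longlongrightarrow> 0) at_top" if i: "i < N" and k: "k < n" for i k
  proof (rule linear_ode_tendsto_zero[OF _ _ AF(1)])
    show "solves_linear_ode n (\<lambda>i j. A i j + BF i j)
        (\<lambda>k t. apply_mat N L (\<lambda>j. D j k t) i - E i k t) (Ch i)"
      unfolding solves_linear_ode_def
    proof (intro allI impI)
      fix k and t :: real assume k: "k < n" and t: "t \<ge> 0"
      show "(Ch i k has_vector_derivative
          apply_mat n (\<lambda>i j. A i j + BF i j) (\<lambda>j. Ch i j t) k
            + (apply_mat N L (\<lambda>j. D j k t) i - E i k t)) (at t within {0..})"
        using Ch[OF i k t] by (simp add: D_def E_def apply_mat_plus apply_mat_diff algebra_simps)
    qed
    show "((\<lambda>t. apply_mat N L (\<lambda>j. D j k t) i - E i k t) \<longlongrightarrow> 0) at_top" if "k < n" for k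
      using tendsto_diff[OF LD[OF i that] E[OF i that]] by simp
  qed (use AF k in auto)
  have "((\<lambda>t. (D i k t - D j k t) + (Ch i k t - Ch j k t)) \<longlongrightarrow> 0 + (0 - 0)) at_top"
    using ijk by (intro tendsto_add tendsto_diff D Ch0)
  then show ?thesis by (simp add: D_def)
qed

section \<open>Realization of the protocol by real matrices\<close>

lemma net_sum_eq_mult_mat_vec:
  assumes "M \<in> carrier_mat m n" "\<And>j. j < N \<Longrightarrow> z j \<in> carrier_vec n"
  shows "net_sum N a M z i = M *\<^sub>v vec n (\<lambda>l. \<Sum>j<N. laplacian N a i j * z j $ l)"
proof (rule eq_vecI)
  fix k assume "k < dim_vec (M *\<^sub>v vec n (\<lambda>l. \<Sum>j<N. laplacian N a i j * z j $ l))"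
  then have k: "k < m" using assms by simp
  have "net_sum N a M z i $ k = (\<Sum>j<N. \<Sum>l<n. laplacian N a i j * (M $$ (k, l) * z j $ l))"
    using assms k by (simp add: net_sum_def index_mult_mat_vec_sum sum_distrib_left del: index_mult_mat_vec)
  also have "\<dots> = (\<Sum>l<n. M $$ (k, l) * (\<Sum>j<N. laplacian N a i j * z j $ l))"
    by (subst sum.swap) (simp add: sum_distrib_left mult_ac)
  also have "\<dots> = (M *\<^sub>v vec n (\<lambda>l. \<Sum>j<N. laplacian N a i j * z j $ l)) $ k"
    using assms k by (subst index_mult_mat_vec_sum[of _ m n]) auto
  finally show "net_sum N a M z i $ k = (M *\<^sub>v vec n (\<lambda>l. \<Sum>j<N. laplacian N a i j * z j $ l)) $ k" .
qed (use assms in \<open>simp add: net_sum_def\<close>)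

lemma has_vector_derivative_complex_of_real:
  assumes "(f has_real_derivative d) (at t within S)" "complex_of_real d = D"
  shows "((\<lambda>s. complex_of_real (f s)) has_vector_derivative D) (at t within S)"
  unfolding assms(2)[symmetric] by (rule has_vector_derivative_of_real[OF assms(1)])

lemma complex_of_real_mult_mat_vec:
  assumes "M \<in> carrier_mat m n" "v \<in> carrier_vec n" "k < m"
  shows "complex_of_real ((M *\<^sub>v v) $ k) = apply_mat n (\<lambda>i j. complex_of_real (M $$ (i, j))) (\<lambda>l. complex_of_real (v $ l)) k"
  by (subst index_mult_mat_vec_sum[OF assms]) (simp add: apply_mat_def)

lemma zero_mat_mult_vec: "v \<in> carrier_vec m \<Longrightarrow> 0\<^sub>m n m *\<^sub>v v = 0\<^sub>v n"
  by (auto intro!: eq_vecI simp: scalar_prod_def)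

theorem scale_free_sync_solvable_if:
  fixes A B C :: "real mat"
  assumes A: "A \<in> carrier_mat n n" and B: "B \<in> carrier_mat n m" and C: "C \<in> carrier_mat p n"
    and stab: "stabilizable A B" and det: "detectable C A" and left: "eigs_closed_left A"
  shows "scale_free_sync_solvable A B C"
proof -
  obtain F where F: "F \<in> carrier_mat m n" and hF: "hurwitz (A + B * F)"
    using stab A B by (auto simp: stabilizable_def)
  obtain K where K: "K \<in> carrier_mat n p" and hK: "hurwitz (A + K * C)"
    using det A C by (auto simp: detectable_def)
  have BF: "B * F \<in> carrier_mat n n" and KC: "K * C \<in> carrier_mat n n" using B F K C by auto
  \<comment> \<open>The protocol state stacks Xh on top of Ch. The blocks encode Xh' = A Xh + K (C
    Xh - zeta) + B F (L Ch) and Ch' = Xh + (A + B F) Ch - L Ch, where zeta = C (L X).\<close>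
  define Ac where "Ac = four_block_mat (A + K * C) (0\<^sub>m n n) (1\<^sub>m n) (A + B * F)"
  define Bc where "Bc = (- K) @\<^sub>r 0\<^sub>m n p"
  define Ec where "Ec = (B * F) @\<^sub>r (- 1\<^sub>m n)"
  \<comment> \<open>Only Ch is exchanged, so q = n and \<open>Hc\<close> selects the lower half of
    the protocol state. The input F Ch is then \<open>F * Hc\<close> applied to it, and
    \<open>G1\<close> and \<open>G2\<close> are taken to be zero.\<close>
  define Hc :: "real mat" where "Hc = mat n (n + n) (\<lambda>(i, j). if j = n + i then 1 else 0)"
  define Fc where "Fc = F * Hc"
  have carr: "Ac \<in> carrier_mat (n + n) (n + n)" "Bc \<in> carrier_mat (n + n) p"
    "Ec \<in> carrier_mat (n + n) n" "Fc \<in> carrier_mat m (n + n)" "Hc \<in> carrier_mat n (n + n)"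
    using A BF KC K F
    by (auto simp: Ac_def Bc_def Ec_def Fc_def Hc_def intro!: four_block_carrier_mat carrier_append_rows)
  have Hc: "Hc *\<^sub>v v = vec n (\<lambda>k. v $ (n + k))" if "v \<in> carrier_vec (n + n)" for v
  proof (rule eq_vecI)
    fix k assume k: "k < dim_vec (vec n (\<lambda>k. v $ (n + k)))"
    have "(Hc *\<^sub>v v) $ k = (\<Sum>j<n+n. if j = n + k then v $ (n + k) else 0)"
      using k that carr(5) by (subst index_mult_mat_vec_sum[of _ n "n + n"]) (auto simp: Hc_def if_distrib[of "\<lambda>x. x * _"] cong: if_cong)
    then show "(Hc *\<^sub>v v) $ k = vec n (\<lambda>k. v $ (n + k)) $ k" using k by simp
  qed (simp add: Hc_def)
  have sync: "((\<lambda>t. x i t $ k - x j t $ k) \<longlongrightarrow> 0) at_top"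
    if a: "is_weighted_digraph N a" and tree: "has_directed_spanning_tree N a"
      and sol: "closed_loop_solution A B C Ac Bc Ec Fc (0\<^sub>m m p) (0\<^sub>m m n) Hc N a x xc"
      and ijk: "i < N" "j < N" "k < n" for N a i j k and x xc :: "nat \<Rightarrow> real \<Rightarrow> real vec"
  proof -
    define lx where "lx i t = vec n (\<lambda>l. \<Sum>j<N. laplacian N a i j * x j t $ l)" for i t
    define lc where "lc i t = vec n (\<lambda>l. \<Sum>j<N. laplacian N a i j * xc j t $ (n + l))" for i t
    define xh where "xh i t = vec n (\<lambda>l. xc i t $ l)" for i t
    define ch where "ch i t = vec n (\<lambda>l. xc i t $ (n + l))" for i t
    have carrv: "x i t \<in> carrier_vec n" "xc i t \<in> carrier_vec (n + n)" if "i < N" "t \<ge> 0" for i t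
      using sol that A carr(1) by (auto simp: closed_loop_solution_def)
    have [simp]: "lx i t \<in> carrier_vec n" "lc i t \<in> carrier_vec n" "xh i t \<in> carrier_vec n"
      "ch i t \<in> carrier_vec n" for i t
      by (auto simp: lx_def lc_def xh_def ch_def)
    have [simp]: "dim_vec (lc i t) = n" for i t by (simp add: lc_def)
    have xc: "xc i t = xh i t @\<^sub>v ch i t" if "i < N" "t \<ge> 0" for i t
      using carrv[OF that] by (intro eq_vecI) (auto simp: xh_def ch_def)
    have zeta: "net_sum N a C (\<lambda>j. x j t) i = C *\<^sub>v lx i t" if "t \<ge> 0" for i t
      unfolding lx_def using C carrv that by (intro net_sum_eq_mult_mat_vec) auto
    have zetah: "net_sum N a Hc (\<lambda>j. xc j t) i = lc i t" if "t \<ge> 0" for i t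
      using carrv that carr(5) by (intro eq_vecI) (auto simp: net_sum_def lc_def Hc simp del: index_mult_mat_vec)
    have u: "Fc *\<^sub>v xc i t + 0\<^sub>m m p *\<^sub>v (C *\<^sub>v lx i t) + 0\<^sub>m m n *\<^sub>v lc i t = F *\<^sub>v ch i t"
      if "i < N" "t \<ge> 0" for i t
    proof -
      have "Fc *\<^sub>v xc i t = F *\<^sub>v ch i t"
        unfolding Fc_def ch_def using F carr(5) carrv[OF that]
        by (subst assoc_mult_mat_vec[of _ m n _ "n + n"]) (auto simp: Hc)
      moreover have "0\<^sub>m m p *\<^sub>v (C *\<^sub>v lx i t) = 0\<^sub>v m" "0\<^sub>m m n *\<^sub>v lc i t = 0\<^sub>v m"
        using C by (auto intro!: zero_mat_mult_vec)
      ultimately show ?thesis using F by simp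
    qed
    have dx: "has_vderiv (x i) (A *\<^sub>v x i t + (B * F) *\<^sub>v ch i t) t"
      and dxc: "has_vderiv (xc i) (Ac *\<^sub>v xc i t + Bc *\<^sub>v (C *\<^sub>v lx i t) + Ec *\<^sub>v lc i t) t"
      if "i < N" "t \<ge> 0" for i t
    proof -
      have BF_ch: "B *\<^sub>v (F *\<^sub>v ch i t) = (B * F) *\<^sub>v ch i t" for i t
        using B F by (subst assoc_mult_mat_vec[of _ n m _ n]) auto
      show "has_vderiv (x i) (A *\<^sub>v x i t + (B * F) *\<^sub>v ch i t) t"
        "has_vderiv (xc i) (Ac *\<^sub>v xc i t + Bc *\<^sub>v (C *\<^sub>v lx i t) + Ec *\<^sub>v lc i t) t"
        using sol that by (auto simp: closed_loop_solution_def Let_def zeta zetah u BF_ch)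
    qed
    have dxc_eq: "Ac *\<^sub>v xc i t + Bc *\<^sub>v (C *\<^sub>v lx i t) + Ec *\<^sub>v lc i t
        = ((A + K * C) *\<^sub>v xh i t + (- K) *\<^sub>v (C *\<^sub>v lx i t) + (B * F) *\<^sub>v lc i t)
          @\<^sub>v (xh i t + (A + B * F) *\<^sub>v ch i t - lc i t)"
      if "i < N" "t \<ge> 0" for i t
    proof -
      have "Ac *\<^sub>v xc i t = ((A + K * C) *\<^sub>v xh i t) @\<^sub>v (xh i t + (A + B * F) *\<^sub>v ch i t)"
        unfolding Ac_def xc[OF that] using A KC BF
        by (subst four_block_mat_mult_vec[of _ n n _ n _ n]) (auto simp: zero_mat_mult_vec right_zero_vec[OF mult_mat_vec_carrier[of _ n n]])
      moreover have "Bc *\<^sub>v (C *\<^sub>v lx i t) = ((- K) *\<^sub>v (C *\<^sub>v lx i t)) @\<^sub>v 0\<^sub>v n"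
        unfolding Bc_def using K C
        by (subst mat_mult_append[of _ n p _ n]) (auto simp: zero_mat_mult_vec)
      moreover have "Ec *\<^sub>v lc i t = ((B * F) *\<^sub>v lc i t) @\<^sub>v (- lc i t)"
        unfolding Ec_def using BF
        by (subst mat_mult_append[of _ n n _ n]) auto
      moreover have "(A + K * C) *\<^sub>v xh i t \<in> carrier_vec n" "(- K) *\<^sub>v (C *\<^sub>v lx i t) \<in> carrier_vec n"
        "(B * F) *\<^sub>v lc i t \<in> carrier_vec n" "(A + B * F) *\<^sub>v ch i t \<in> carrier_vec n"
        using A K C BF KC
        by (auto intro!: carrier_vecI)
      moreover have "xh i t + v + 0\<^sub>v n + - lc i t = xh i t + v - lc i t" if "v \<in> carrier_vec n" for v
        using that by (auto intro!: eq_vecI simp: lc_def)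
      ultimately show ?thesis
        by (simp only: append_vec_add[of _ n _ _ n] add_carrier_vec zero_carrier_vec uminus_carrier_vec
            \<open>xh i t \<in> carrier_vec n\<close> \<open>lc i t \<in> carrier_vec n\<close>)
    qed
    let ?X = "\<lambda>i k t. complex_of_real (x i t $ k)"
    let ?Xh = "\<lambda>i k t. complex_of_real (xh i t $ k)"
    let ?Ch = "\<lambda>i k t. complex_of_real (ch i t $ k)"
    let ?c = "\<lambda>M i j. complex_of_real (M $$ (i, j))"
    have lx: "complex_of_real (lx i t $ l) = apply_mat N (complex_laplacian N a) (\<lambda>j. ?X j l t) i"
      if "l < n" for i l t
      using that by (simp add: lx_def apply_mat_def)
    have lc: "complex_of_real (lc i t $ l) = apply_mat N (complex_laplacian N a) (\<lambda>j. ?Ch j l t) i"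
      if "l < n" for i l t
      using that by (simp add: lc_def ch_def apply_mat_def)
    obtain as where as: "annihilated_by n (?c A) as" "\<And>s. s \<in> set as \<Longrightarrow> Re s \<le> 0"
      using annihilated_by_eigenvalues_real[OF A] left unfolding eigs_closed_left_def by metis
    obtain ks where ks: "annihilated_by n (?c (A + K * C)) ks" "\<And>s. s \<in> set ks \<Longrightarrow> Re s < 0"
      using annihilated_by_eigenvalues_real[of "A + K * C" n] A KC hK unfolding hurwitz_def
      by (metis add_carrier_mat)
    obtain fs where fs: "annihilated_by n (?c (A + B * F)) fs" "\<And>s. s \<in> set fs \<Longrightarrow> Re s < 0"
      using annihilated_by_eigenvalues_real[of "A + B * F" n] A BF hF unfolding hurwitz_def
      by (metis add_carrier_mat)
    have ks': "annihilated_by n (\<lambda>i j. ?c A i j + ?c (K * C) i j) ks"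
      by (rule annihilated_by_cong[OF _ ks(1)]) (simp add: carrier_matD[OF KC] del: index_mult_mat)
    have fs': "annihilated_by n (\<lambda>i j. ?c A i j + ?c (B * F) i j) fs"
      by (rule annihilated_by_cong[OF _ fs(1)]) (simp add: carrier_matD[OF BF] del: index_mult_mat)
    have "((\<lambda>t. ?X i k t - ?X j k t) \<longlongrightarrow> 0) at_top"
    proof (rule protocol_synchronizes[OF a tree refl as ks' ks(2) fs' fs(2), where Xh = ?Xh and Ch = ?Ch])
      fix i k and t :: real assume *: "i < N" "k < n" "t \<ge> 0"
      show "(?X i k has_vector_derivative apply_mat n (?c A) (\<lambda>l. ?X i l t) k
          + apply_mat n (?c (B * F)) (\<lambda>l. ?Ch i l t) k) (at t within {0..})"
      proof (rule has_vector_derivative_complex_of_real)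
        show "((\<lambda>t. x i t $ k) has_real_derivative ((A *\<^sub>v x i t + (B * F) *\<^sub>v ch i t) $ k)) (at t within {0..})"
          using dx[of i t, unfolded has_vderiv_def, rule_format, of k] * carrier_matD(1)[OF B] by simp
        show "complex_of_real ((A *\<^sub>v x i t + (B * F) *\<^sub>v ch i t) $ k) = apply_mat n (?c A) (\<lambda>l. ?X i l t) k
          + apply_mat n (?c (B * F)) (\<lambda>l. ?Ch i l t) k"
          using * A BF carrv[of i t] carrier_matD(1)[OF B]
          by (simp add: complex_of_real_mult_mat_vec[of _ n n] del: index_mult_mat_vec)
      qed
      let ?d1 = "(A + K * C) *\<^sub>v xh i t + (- K) *\<^sub>v (C *\<^sub>v lx i t) + (B * F) *\<^sub>v lc i t"
      let ?d2 = "xh i t + (A + B * F) *\<^sub>v ch i t - lc i t"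
      have d: "has_vderiv (xc i) (?d1 @\<^sub>v ?d2) t" using dxc dxc_eq * by metis
      have dim: "dim_vec ?d1 = n" "dim_vec ?d2 = n"
        using carrier_matD(1)[OF B] by auto
      have d1: "((\<lambda>t. xc i t $ k) has_real_derivative (?d1 $ k)) (at t within {0..})"
        using d[unfolded has_vderiv_def, rule_format, of k] * dim by simp
      have d2: "((\<lambda>t. xc i t $ (n + k)) has_real_derivative (?d2 $ k)) (at t within {0..})"
        using d[unfolded has_vderiv_def, rule_format, of "n + k"] * dim by simp
      have KClx: "(- K) *\<^sub>v (C *\<^sub>v lx i t) = - ((K * C) *\<^sub>v lx i t)"
        using K C by (auto intro!: eq_vecI simp: assoc_mult_mat_vec[of _ n p _ n])
      show "(?Xh i k has_vector_derivative apply_mat n (?c A) (\<lambda>l. ?Xh i l t) k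
          + apply_mat n (?c (K * C)) (\<lambda>l. ?Xh i l t) k
          - apply_mat n (?c (K * C)) (\<lambda>l. apply_mat N (complex_laplacian N a) (\<lambda>j. ?X j l t) i) k
          + apply_mat n (?c (B * F)) (\<lambda>l. apply_mat N (complex_laplacian N a) (\<lambda>j. ?Ch j l t) i) k)
          (at t within {0..})"
      proof (rule has_vector_derivative_complex_of_real)
        show "((\<lambda>t. xh i t $ k) has_real_derivative (?d1 $ k)) (at t within {0..})"
          using d1 * by (simp add: xh_def)
        have "?d1 $ k = (A *\<^sub>v xh i t) $ k + ((K * C) *\<^sub>v xh i t) $ k - ((K * C) *\<^sub>v lx i t) $ k
            + ((B * F) *\<^sub>v lc i t) $ k"
          using * A KC BF carrier_matD(1)[OF B] carrier_matD(1)[OF K] by (simp add: KClx add_mult_distrib_mat_vec[of _ n n] del: index_mult_mat_vec)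
        then show "complex_of_real (?d1 $ k) = apply_mat n (?c A) (\<lambda>l. ?Xh i l t) k
          + apply_mat n (?c (K * C)) (\<lambda>l. ?Xh i l t) k
          - apply_mat n (?c (K * C)) (\<lambda>l. apply_mat N (complex_laplacian N a) (\<lambda>j. ?X j l t) i) k
          + apply_mat n (?c (B * F)) (\<lambda>l. apply_mat N (complex_laplacian N a) (\<lambda>j. ?Ch j l t) i) k"
          using * A KC BF
          by (simp add: complex_of_real_mult_mat_vec[of _ n n] lx lc del: index_mult_mat_vec cong: apply_mat_cong)
      qed
      show "(?Ch i k has_vector_derivative ?Xh i k t + apply_mat n (?c A) (\<lambda>l. ?Ch i l t) k
          + apply_mat n (?c (B * F)) (\<lambda>l. ?Ch i l t) k
          - apply_mat N (complex_laplacian N a) (\<lambda>j. ?Ch j k t) i) (at t within {0..})"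
      proof (rule has_vector_derivative_complex_of_real)
        show "((\<lambda>t. ch i t $ k) has_real_derivative (?d2 $ k)) (at t within {0..})"
          using d2 * by (simp add: ch_def)
        have "?d2 $ k = xh i t $ k + (A *\<^sub>v ch i t) $ k + ((B * F) *\<^sub>v ch i t) $ k - lc i t $ k"
          using * A BF carrier_matD(1)[OF B] by (simp add: add_mult_distrib_mat_vec[of _ n n] lc_def del: index_mult_mat_vec)
        then show "complex_of_real (?d2 $ k) = ?Xh i k t + apply_mat n (?c A) (\<lambda>l. ?Ch i l t) k
          + apply_mat n (?c (B * F)) (\<lambda>l. ?Ch i l t) k
          - apply_mat N (complex_laplacian N a) (\<lambda>j. ?Ch j k t) i"
          using * A BF
          by (simp add: complex_of_real_mult_mat_vec[of _ n n] lc del: index_mult_mat_vec)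
      qed
    qed (use ijk in auto)
    then show ?thesis
      using tendsto_Re by fastforce
  qed
  show ?thesis
    unfolding scale_free_sync_solvable_def
    by (rule exI[of _ "n + n"], rule exI[of _ n], rule exI[of _ Ac], rule exI[of _ Bc],
      rule exI[of _ Ec], rule exI[of _ Fc], rule exI[of _ "0\<^sub>m m p"], rule exI[of _ "0\<^sub>m m n"],
      rule exI[of _ Hc]) (use A B C carr sync in auto)
qed

section \<open>Stabilizability by the Hautus test\<close>

text \<open>Schur complement of the bordered matrix with respect to its corner 1. Its merit is that
  f occurs only in the first row.\<close>

lemma det_rank_one_update:
  fixes M :: "'a::idom mat"
  assumes M: "M \<in> carrier_mat n n" and b: "b \<in> carrier_mat n 1" and f: "f \<in> carrier_mat 1 n"
  shows "det (M - b * f) = det (four_block_mat (1\<^sub>m 1) f b M)"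
proof -
  let ?P = "four_block_mat (1\<^sub>m 1) (0\<^sub>m 1 n) (- b) (1\<^sub>m n)"
  let ?Q = "four_block_mat (1\<^sub>m 1) f b M"
  have carr: "?P \<in> carrier_mat (1 + n) (1 + n)" "?Q \<in> carrier_mat (1 + n) (1 + n)"
    using M b f by (auto intro!: four_block_carrier_mat)
  have "?P * ?Q = four_block_mat (1\<^sub>m 1 * 1\<^sub>m 1 + 0\<^sub>m 1 n * b) (1\<^sub>m 1 * f + 0\<^sub>m 1 n * M)
      (- b * 1\<^sub>m 1 + 1\<^sub>m n * b) (- b * f + 1\<^sub>m n * M)"
    using M b f by (intro mult_four_block_mat) auto
  also have "\<dots> = four_block_mat (1\<^sub>m 1) f (0\<^sub>m n 1) (M - b * f)"
    using M b f by (intro cong_four_block_mat) auto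
  finally have "det ?P * det ?Q = det (four_block_mat (1\<^sub>m 1) f (0\<^sub>m n 1) (M - b * f))"
    using det_mult[OF carr] by simp
  moreover have "det ?P = 1"
    using b by (subst det_four_block_mat_upper_right_zero[of _ 1 _ n]) auto
  moreover have "det (four_block_mat (1\<^sub>m 1) f (0\<^sub>m n 1) (M - b * f)) = det (M - b * f)"
    using M b f by (subst det_four_block_mat_lower_left_zero[of _ 1 _ n]) auto
  ultimately show ?thesis by simp
qed

text \<open>The matrix determinant lemma: column elimination in the same bordered matrix leaves the
  1 by 1 Schur complement 1 - f b.\<close>

lemma det_one_minus_rank_one:
  fixes b :: "'a::idom mat"
  assumes b: "b \<in> carrier_mat n 1" and f: "f \<in> carrier_mat 1 n"
  shows "det (1\<^sub>m n - b * f) = 1 - (f * b) $$ (0, 0)"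
proof -
  let ?P = "four_block_mat (1\<^sub>m 1) (0\<^sub>m 1 n) (- b) (1\<^sub>m n)"
  let ?Q = "four_block_mat (1\<^sub>m 1) f b (1\<^sub>m n)"
  have carr: "?P \<in> carrier_mat (1 + n) (1 + n)" "?Q \<in> carrier_mat (1 + n) (1 + n)"
    using b f by (auto intro!: four_block_carrier_mat)
  have "?Q * ?P = four_block_mat (1\<^sub>m 1 * 1\<^sub>m 1 + f * - b) (1\<^sub>m 1 * 0\<^sub>m 1 n + f * 1\<^sub>m n)
      (b * 1\<^sub>m 1 + 1\<^sub>m n * - b) (b * 0\<^sub>m 1 n + 1\<^sub>m n * 1\<^sub>m n)"
    using b f by (intro mult_four_block_mat) auto
  also have "\<dots> = four_block_mat (1\<^sub>m 1 - f * b) f (0\<^sub>m n 1) (1\<^sub>m n)"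
    using b f by (intro cong_four_block_mat) auto
  finally have "det ?Q * det ?P = det (four_block_mat (1\<^sub>m 1 - f * b) f (0\<^sub>m n 1) (1\<^sub>m n))"
    using det_mult[OF carr(2,1)] by simp
  moreover have "det ?P = 1"
    using b by (subst det_four_block_mat_upper_right_zero[of _ 1 _ n]) auto
  moreover have "det (four_block_mat (1\<^sub>m 1 - f * b) f (0\<^sub>m n 1) (1\<^sub>m n)) = det (1\<^sub>m 1 - f * b)"
    using b f by (subst det_four_block_mat_lower_left_zero[of _ 1 _ n]) auto
  moreover have "det (1\<^sub>m 1 - f * b) = 1 - (f * b) $$ (0, 0)"
    using b f by (subst det_single) auto
  ultimately show ?thesis using det_rank_one_update[OF _ b f, of "1\<^sub>m n"] by simp
qed

text \<open>The bordered determinant is affine in its first row.\<close>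

lemma det_rank_one_update_midpoint:
  fixes M :: "complex mat"
  assumes M: "M \<in> carrier_mat n n" and b: "b \<in> carrier_mat n 1"
    and f: "f \<in> carrier_mat 1 n" and g: "g \<in> carrier_mat 1 n"
  shows "2 * det (M - b * ((1/2) \<cdot>\<^sub>m (f + g))) = det (M - b * f) + det (M - b * g)"
proof -
  let ?h = "(1/2) \<cdot>\<^sub>m (f + g)"
  let ?Q = "\<lambda>f. four_block_mat (1\<^sub>m 1) f b M"
  have h: "?h \<in> carrier_mat 1 n" using f g by simp
  have carr: "?Q f \<in> carrier_mat (Suc n) (Suc n)" if "f \<in> carrier_mat 1 n" for f
    using that M b four_block_carrier_mat[of "1\<^sub>m 1" 1 1 M n n f b] by simp
  have cof: "cofactor (?Q f') 0 j = cofactor (?Q f) 0 j" if "f' \<in> carrier_mat 1 n" for f' j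
    unfolding cofactor_def using that f M b
    by (intro arg_cong2[of _ _ _ _ "(*)"] arg_cong[of _ _ det] refl) (auto simp: mat_delete_def intro!: eq_matI)
  have "det (M - b * f') = (\<Sum>j<Suc n. ?Q f' $$ (0, j) * cofactor (?Q f) 0 j)"
    if "f' \<in> carrier_mat 1 n" for f'
    unfolding det_rank_one_update[OF M b that]
    using laplace_expansion_row[OF carr[OF that], of 0] cof[OF that] by simp
  note expand = this
  \<comment> \<open>The corner entry 1 fits as well, because the midpoint weights sum to 1. The
    cofactors along this row do not see f.\<close>
  have "2 * ?Q ?h $$ (0, j) = ?Q f $$ (0, j) + ?Q g $$ (0, j)" if "j < Suc n" for j
    using f g M b that by (cases "j = 0") auto
  then have "2 * (?Q ?h $$ (0, j) * c) = ?Q f $$ (0, j) * c + ?Q g $$ (0, j) * c" if "j < Suc n" for j c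
    using that by (simp only: distrib_right[symmetric] mult.assoc[symmetric])
  then show ?thesis
    unfolding expand[OF h] expand[OF f] expand[OF g] sum_distrib_left sum.distrib[symmetric]
    by (intro sum.cong refl) (simp only: lessThan_iff)
qed

lemma poly_char_poly:
  fixes A :: "'a::field mat"
  assumes "A \<in> carrier_mat n n"
  shows "poly (char_poly A) z = det (z \<cdot>\<^sub>m 1\<^sub>m n - A)"
  unfolding char_poly_matrix[OF assms]
  by (rule arg_cong[of _ _ det]) (use assms in \<open>auto simp: char_matrix_def intro!: eq_matI\<close>)

text \<open>Brauer's rank-one update: feeding back a multiple of a left eigenvector moves only the
  corresponding eigenvalue.\<close>

lemma char_poly_left_eigenvector_update:
  fixes A :: "complex mat"
  assumes A: "A \<in> carrier_mat n n" and b: "b \<in> carrier_mat n 1" and w: "w \<in> carrier_mat 1 n"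
    and ev: "w * A = \<mu> \<cdot>\<^sub>m w" and \<mu>: "poly (char_poly A) \<mu> = 0"
  shows "char_poly (A + b * (c \<cdot>\<^sub>m w)) * [:- \<mu>, 1:]
    = char_poly A * [:- (\<mu> + c * (w * b) $$ (0, 0)), 1:]"
proof (rule poly_eq_poly_eq_iff[THEN iffD1], rule ext)
  fix z
  let ?A = "A + b * (c \<cdot>\<^sub>m w)"
  have carr: "?A \<in> carrier_mat n n" using A b w by simp
  show "poly (char_poly ?A * [:- \<mu>, 1:]) z
      = poly (char_poly A * [:- (\<mu> + c * (w * b) $$ (0, 0)), 1:]) z"
  proof (cases "z = \<mu>")
    case True
    then show ?thesis using \<mu> by simp
  next
    case False
    \<comment> \<open>As w (z - A) = (z - \<mu>) w, this d satisfies d w (z - A) = c w. Hence z - A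
      - c b w = (1 - d b w) (z - A), and the determinant splits. At z = \<mu> both sides of the
      claim are zero.\<close>
    define d where "d = c / (z - \<mu>)"
    let ?Z = "z \<cdot>\<^sub>m 1\<^sub>m n - A"
    have Z: "?Z \<in> carrier_mat n n" using A by (rule minus_carrier_mat)
    have "w * ?Z = w * (z \<cdot>\<^sub>m 1\<^sub>m n) - w * A"
      using w A by (intro mult_minus_distrib_mat[of _ 1 n]) auto
    also have "\<dots> = (z - \<mu>) \<cdot>\<^sub>m w"
      using w by (simp add: ev mult_smult_distrib[of _ 1 n]) (auto intro!: eq_matI simp: algebra_simps)
    finally have wZ: "w * ?Z = (z - \<mu>) \<cdot>\<^sub>m w" .
    have "(1\<^sub>m n - b * (d \<cdot>\<^sub>m w)) * ?Z = ?Z - b * (d \<cdot>\<^sub>m w) * ?Z"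
      using b w Z by (subst minus_mult_distrib_mat[of _ n n]) auto
    also have "b * (d \<cdot>\<^sub>m w) * ?Z = b * (d \<cdot>\<^sub>m (w * ?Z))"
      using b w Z
      by (subst assoc_mult_mat[of _ n 1 _ n _ n]) (auto simp: mult_smult_assoc_mat[of _ "Suc 0" n _ n])
    also have "d \<cdot>\<^sub>m (w * ?Z) = c \<cdot>\<^sub>m w"
      unfolding wZ using False w by (auto intro!: eq_matI simp: d_def)
    finally have "(1\<^sub>m n - b * (d \<cdot>\<^sub>m w)) * ?Z = z \<cdot>\<^sub>m 1\<^sub>m n - ?A"
      using A b w by (auto intro!: eq_matI)
    moreover have "1\<^sub>m n - b * (d \<cdot>\<^sub>m w) \<in> carrier_mat n n"
      using b w by (intro minus_carrier_mat) auto
    ultimately have "poly (char_poly ?A) z = det (1\<^sub>m n - b * (d \<cdot>\<^sub>m w)) * det ?Z"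
      unfolding poly_char_poly[OF carr] using det_mult[of "1\<^sub>m n - b * (d \<cdot>\<^sub>m w)" n ?Z] b w Z by simp
    also have "\<dots> = (1 - d * (w * b) $$ (0, 0)) * poly (char_poly A) z"
      using b w det_one_minus_rank_one[OF b, of "d \<cdot>\<^sub>m w"]
      by (simp add: poly_char_poly[OF A] mult_smult_assoc_mat[of _ 1 n])
    finally show ?thesis using False by (simp add: d_def field_simps)
  qed
qed

text \<open>The Hautus test in left-eigenvector form, restricted to the closed right half plane and
  therefore characterizing stabilizability. Row vectors are 1 by n matrices so that they multiply
  with b and with gains.\<close>

definition hautus_controllable :: "nat \<Rightarrow> complex mat \<Rightarrow> complex mat \<Rightarrow> bool" where
  "hautus_controllable n A b \<longleftrightarrow> (\<forall>w\<in>carrier_mat 1 n. \<forall>\<mu>.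
     w \<noteq> 0\<^sub>m 1 n \<and> w * A = \<mu> \<cdot>\<^sub>m w \<and> Re \<mu> \<ge> 0 \<longrightarrow> (w * b) $$ (0, 0) \<noteq> 0)"

text \<open>A row w with w b = 0 does not notice the feedback: w (A + b f) = w A, so a violation
  after feedback is already one before it.\<close>

lemma hautus_controllable_feedback:
  assumes A: "A \<in> carrier_mat n n" and b: "b \<in> carrier_mat n 1" and f: "f \<in> carrier_mat 1 n"
    and h: "hautus_controllable n A b"
  shows "hautus_controllable n (A + b * f) b"
  unfolding hautus_controllable_def
proof (intro ballI allI impI notI)
  fix w \<mu> assume w: "w \<in> carrier_mat 1 n" and wb: "(w * b) $$ (0, 0) = 0"
    and ev: "w \<noteq> 0\<^sub>m 1 n \<and> w * (A + b * f) = \<mu> \<cdot>\<^sub>m w \<and> Re \<mu> \<ge> 0"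
  have "w * b = 0\<^sub>m 1 1" using w b wb by (auto intro!: eq_matI)
  then have "w * (b * f) = 0\<^sub>m 1 n"
    using w b f by (subst assoc_mult_mat[symmetric, of _ 1 n _ 1 _ n]) auto
  then have "w * A = w * (A + b * f)"
    using w A b f by (simp add: mult_add_distrib_mat[of _ 1 n _ n])
  then show False using h w wb ev by (auto simp: hautus_controllable_def)
qed

lemma left_eigenvector_exists:
  fixes A :: "complex mat"
  assumes A: "A \<in> carrier_mat n n" and \<mu>: "poly (char_poly A) \<mu> = 0"
  obtains w where "w \<in> carrier_mat 1 n" "w \<noteq> 0\<^sub>m 1 n" "w * A = \<mu> \<cdot>\<^sub>m w"
proof -
  have "eigenvalue (transpose_mat A) \<mu>"
    using A \<mu> by (simp add: eigenvalue_root_char_poly[of _ n])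
  then obtain v where v: "v \<in> carrier_vec n" "v \<noteq> 0\<^sub>v n" "transpose_mat A *\<^sub>v v = \<mu> \<cdot>\<^sub>v v"
    using A by (auto simp: eigenvalue_def eigenvector_def)
  define w where "w = mat 1 n (\<lambda>(i, j). v $ j)"
  have "w \<noteq> 0\<^sub>m 1 n"
  proof
    assume "w = 0\<^sub>m 1 n"
    then have "v $ j = 0" if "j < n" for j
    proof -
      have "v $ j = w $$ (0, j)" using that by (simp add: w_def)
      then show ?thesis using that \<open>w = 0\<^sub>m 1 n\<close> by simp
    qed
    then show False using v by (auto intro!: eq_vecI)
  qed
  moreover have "w * A = \<mu> \<cdot>\<^sub>m w"
  proof (rule eq_matI)
    fix i j assume ij: "i < dim_row (\<mu> \<cdot>\<^sub>m w)" "j < dim_col (\<mu> \<cdot>\<^sub>m w)"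
    then have "(w * A) $$ (i, j) = (transpose_mat A *\<^sub>v v) $ j"
      using A v(1) by (auto simp: w_def scalar_prod_def mult_ac intro!: sum.cong)
    also have "\<dots> = (\<mu> \<cdot>\<^sub>m w) $$ (i, j)" using ij v by (simp add: v(3)) (simp add: w_def)
    finally show "(w * A) $$ (i, j) = (\<mu> \<cdot>\<^sub>m w) $$ (i, j)" .
  qed (use A in \<open>auto simp: w_def\<close>)
  ultimately show ?thesis using that[of w] by (simp add: w_def)
qed

text \<open>Each step takes a left eigenvector of the current matrix, moves its eigenvalue to -1 and
  leaves the other roots with their multiplicities. The Hautus property survives the feedback, and
  the successive gains add up to one.\<close>

lemma shift_unstable_eigenvalues:
  fixes A :: "complex mat"
  assumes A: "A \<in> carrier_mat n n" and b: "b \<in> carrier_mat n 1" and h: "hautus_controllable n A b"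
    and cp: "char_poly A = (\<Prod>s\<leftarrow>bs. [:- s, 1:]) * q" and bs: "\<And>s. s \<in> set bs \<Longrightarrow> Re s \<ge> 0"
  shows "\<exists>f\<in>carrier_mat 1 n. char_poly (A + b * f) = [:1, 1:] ^ length bs * q"
  using A h cp bs
proof (induction bs arbitrary: A q)
  case Nil
  then show ?case using b by (intro bexI[of _ "0\<^sub>m 1 n"]) auto
next
  case (Cons \<mu> bs)
  note A = Cons.prems(1)
  have \<mu>: "poly (char_poly A) \<mu> = 0" by (simp add: Cons.prems(3))
  obtain w where w: "w \<in> carrier_mat 1 n" "w \<noteq> 0\<^sub>m 1 n" "w * A = \<mu> \<cdot>\<^sub>m w"
    using left_eigenvector_exists[OF A \<mu>] by blast
  \<comment> \<open>Solves \<mu> + c (w b) = -1. The denominator is nonzero by the Hautus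
    property.\<close>
  define c where "c = (- 1 - \<mu>) / (w * b) $$ (0, 0)"
  have "(w * b) $$ (0, 0) \<noteq> 0"
    using Cons.prems(2,4) w by (auto simp: hautus_controllable_def simp del: index_mult_mat)
  then have c: "\<mu> + c * (w * b) $$ (0, 0) = - 1" by (simp add: c_def del: index_mult_mat)
  let ?f = "c \<cdot>\<^sub>m w"
  have f: "?f \<in> carrier_mat 1 n" using w by simp
  have "char_poly (A + b * ?f) * [:- \<mu>, 1:] = ((\<Prod>s\<leftarrow>bs. [:- s, 1:]) * ([:1, 1:] * q)) * [:- \<mu>, 1:]"
    unfolding char_poly_left_eigenvector_update[OF A b w(1,3) \<mu>] c Cons.prems(3)
    by (simp only: list.map prod_list.Cons minus_minus mult_ac)
  then have cp1: "char_poly (A + b * ?f) = (\<Prod>s\<leftarrow>bs. [:- s, 1:]) * ([:1, 1:] * q)"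
    by (subst (asm) mult_cancel_right) auto
  have A1: "A + b * ?f \<in> carrier_mat n n" using A b f by simp
  obtain g where g: "g \<in> carrier_mat 1 n"
    "char_poly (A + b * ?f + b * g) = [:1, 1:] ^ length bs * ([:1, 1:] * q)"
    using Cons.IH[OF A1 hautus_controllable_feedback[OF A b f Cons.prems(2)] cp1] Cons.prems(4) by auto
  have "A + b * ?f + b * g = A + b * (?f + g)"
    using A b f g by (simp add: mult_add_distrib_mat[of _ n 1 _ n] assoc_add_mat[of _ n n])
  then have "char_poly (A + b * (?f + g)) = [:1, 1:] ^ length bs * ([:1, 1:] * q)" using g by simp
  also have "\<dots> = [:1, 1:] ^ length (\<mu> # bs) * q"
    by (simp only: list.size power_Suc add_Suc_right add_0_right mult_ac)
  finally show ?case using f g by (intro bexI[of _ "?f + g"]) auto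
qed

section \<open>From complex to real feedback gains\<close>

lemma proots_linear_factors: "proots (\<Prod>s\<leftarrow>ss. [:- s, 1:]) = mset (ss :: 'a::idom list)"
proof (induction ss)
  case (Cons s ss)
  have "(\<Prod>s\<leftarrow>ss. [:- s, 1:]) \<noteq> 0" by (auto simp: prod_list_zero_iff)
  then show ?case using Cons by (simp add: proots_mult del: mult_pCons_left)
qed simp

lemma map_mat_add:
  assumes "M \<in> carrier_mat n m" "M' \<in> carrier_mat n m" "\<And>x y. h (x + y) = h x + h y"
  shows "map_mat h (M + M') = map_mat h M + map_mat h M'"
  using assms by (auto intro!: eq_matI)

interpretation cnj_hom: comm_ring_hom cnj by unfold_locales auto
interpretation cnj_poly_hom: map_poly_comm_ring_hom cnj ..

text \<open>A complex feedback f moves all unstable eigenvalues to -1. The target characteristic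
  polynomial is real, so it is also attained by the conjugate of f, hence by Re f.\<close>

lemma stabilizable_if_hautus:
  fixes A B :: "real mat"
  assumes A: "A \<in> carrier_mat n n" and B: "B \<in> carrier_mat n 1"
    and h: "hautus_controllable n (map_mat complex_of_real A) (map_mat complex_of_real B)"
  shows "stabilizable A B"
proof -
  let ?A = "map_mat complex_of_real A" and ?B = "map_mat complex_of_real B"
  have A': "?A \<in> carrier_mat n n" and B': "?B \<in> carrier_mat n 1" using A B by auto
  obtain ss where ss: "char_poly ?A = (\<Prod>s\<leftarrow>ss. [:- s, 1:])"
    using char_poly_factorized[OF A'] by blast
  \<comment> \<open>Where each eigenvalue is moved. Since g commutes with conjugation, the target T
    is real as soon as the root multiset of A is closed under conjugation.\<close>
  define g where "g s = (if Re s < 0 then s else -1)" for s :: complex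
  define T where "T = (\<Prod>s\<leftarrow>ss. [:- g s, 1:])"
  have split: "(\<Prod>s\<leftarrow>ss. [:- s, 1:])
      = (\<Prod>s\<leftarrow>filter (\<lambda>s. \<not> Re s < 0) ss. [:- s, 1:]) * (\<Prod>s\<leftarrow>filter (\<lambda>s. Re s < 0) ss. [:- s, 1:])"
    for ss :: "complex list"
  proof (induction ss)
    case (Cons s ss)
    then show ?case
      by (cases "Re s < 0")
        (simp_all only: filter.simps list.map prod_list.Cons if_True if_False simp_thms mult_ac)
  qed simp
  have T: "[:1, 1:] ^ length (filter (\<lambda>s. \<not> Re s < 0) ss) * (\<Prod>s\<leftarrow>filter (\<lambda>s. Re s < 0) ss. [:- s, 1:]) = T"
    unfolding T_def
  proof (induction ss)
    case (Cons s ss)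
    have "[:- g s, 1:] = (if Re s < 0 then [:- s, 1:] else [:1, 1:])" by (simp add: g_def)
    with Cons show ?case
      by (cases "Re s < 0")
        (simp_all only: filter.simps list.map list.size prod_list.Cons if_True if_False simp_thms
          add_Suc_right add_0_right power_Suc mult_ac flip: Cons)
  qed simp
  obtain f where f: "f \<in> carrier_mat 1 n" "char_poly (?A + ?B * f) = T"
    using shift_unstable_eigenvalues[OF A' B' h trans[OF ss split]] T by auto
  have cnj_lin: "map_poly cnj [:- s, 1:] = [:- cnj s, 1:]" for s by simp
  have "map_mat cnj ?A = ?A" "map_mat cnj ?B = ?B" by (auto intro!: eq_matI)
  note cnj_AB = this
  have "(\<Prod>s\<leftarrow>ss. [:- s, 1:]) = map_poly cnj (char_poly ?A)"
    using cnj_hom.char_poly_hom[OF A'] by (simp add: cnj_AB ss)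
  also have "\<dots> = (\<Prod>s\<leftarrow>map cnj ss. [:- s, 1:])"
    by (simp add: ss cnj_poly_hom.hom_prod_list o_def del: cnj_poly_hom.prod_list_map_hom)
  \<comment> \<open>A is real, so conjugation fixes its characteristic polynomial and permutes the
    roots with multiplicity.\<close>
  finally have mset: "mset ss = mset (map cnj ss)"
    by (metis proots_linear_factors)
  have "map_poly cnj T = (\<Prod>s\<leftarrow>map cnj ss. [:- g s, 1:])"
    unfolding T_def cnj_poly_hom.hom_prod_list map_map o_def cnj_lin
    by (intro arg_cong[of _ _ prod_list] map_cong) (auto simp: g_def)
  also have "\<dots> = prod_mset (image_mset (\<lambda>s. [:- g s, 1:]) (mset (map cnj ss)))"
    by (metis mset_map prod_mset_prod_list)
  also have "\<dots> = T" unfolding mset[symmetric] T_def by (metis mset_map prod_mset_prod_list)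
  finally have T_real: "map_poly cnj T = T" .
  define f' where "f' = map_mat cnj f"
  have f': "f' \<in> carrier_mat 1 n" using f by (simp add: f'_def)
  have "map_mat cnj (?A + ?B * f) = ?A + ?B * f'"
    using A' B' f
    by (simp add: f'_def map_mat_add[of _ n n] cnj_hom.mat_hom_mult[of _ n 1 _ n] cnj_AB)
  then have cp': "char_poly (?A + ?B * f') = T"
    using cnj_hom.char_poly_hom[of "?A + ?B * f" n] A' B' f T_real by simp
  define F where "F = map_mat Re f"
  have F: "F \<in> carrier_mat 1 n" using f by (simp add: F_def)
  have "map_mat complex_of_real F = (1/2) \<cdot>\<^sub>m (f + f')"
    using f by (auto intro!: eq_matI simp: F_def f'_def complex_eq_iff)
  moreover have "map_mat complex_of_real (A + B * F) = ?A + ?B * map_mat complex_of_real F"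
    using A B F by (simp add: map_mat_add[of _ n n] of_real_hom.mat_hom_mult[of _ n 1 _ n])
  ultimately have ABF: "map_mat complex_of_real (A + B * F) = ?A + ?B * ((1/2) \<cdot>\<^sub>m (f + f'))" by simp
  have "Re z < 0" if "eigenvalue (map_mat complex_of_real (A + B * F)) z" for z
  proof -
    let ?h = "(1/2) \<cdot>\<^sub>m (f + f')"
    have cdet: "poly (char_poly (?A + ?B * f)) z = det ((z \<cdot>\<^sub>m 1\<^sub>m n - ?A) - ?B * f)"
      if "f \<in> carrier_mat 1 n" for f
      using A' B' that
      by (subst poly_char_poly[of _ n]) (auto intro!: arg_cong[of _ _ det] eq_matI)
    have h: "?h \<in> carrier_mat 1 n" using f f' by simp
    have "2 * poly (char_poly (?A + ?B * ?h)) z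
        = poly (char_poly (?A + ?B * f)) z + poly (char_poly (?A + ?B * f')) z"
      unfolding cdet[OF h] cdet[OF f(1)] cdet[OF f'] using A' B' f f'
      by (intro det_rank_one_update_midpoint) auto
    then have "poly (char_poly (?A + ?B * ?h)) z = poly T z" using f cp' by simp
    moreover have "poly (char_poly (?A + ?B * ?h)) z = 0"
      using that A' B' h by (simp add: ABF eigenvalue_root_char_poly[of _ n])
    ultimately have "poly T z = 0" by simp
    then have "z \<in> g ` set ss" by (auto simp: T_def poly_prod_list prod_list_zero_iff)
    then show ?thesis by (auto simp: g_def)
  qed
  then show ?thesis
    using A B F by (auto simp: stabilizable_def hurwitz_def)
qed

section \<open>Necessity\<close>

lemma shifts_apply_eigenvector:
  assumes "\<And>i. i < d \<Longrightarrow> apply_mat d M z i = \<mu> * z i" "i < d"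
  shows "shifts_apply d M ss z i = (\<Prod>s\<leftarrow>ss. \<mu> - s) * z i"
  using assms(2)
proof (induction ss arbitrary: i)
  case (Cons s ss)
  have "apply_mat d M (shifts_apply d M ss z) i = (\<Prod>s\<leftarrow>ss. \<mu> - s) * (\<mu> * z i)"
    using Cons assms(1) by (simp add: apply_mat_cmult cong: apply_mat_cong)
  then show ?case using Cons by (simp add: shift_apply_def[of _ _ s] algebra_simps)
qed simp

text \<open>On z the product acts as the scalar given by the factors \<mu> - s, which is nonzero
  since Re s < 0 while Re \<mu> is not negative. The first n coordinates of the result vanish, hence
  those of z do.\<close>

lemma stable_shifts_right_eigenvector:
  assumes hs: "\<And>s. s \<in> set hs \<Longrightarrow> Re s < 0"
    and ann: "\<And>v i. i < n \<Longrightarrow> shifts_apply d M hs v i = 0" and nd: "n \<le> d"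
    and ev: "\<And>i. i < d \<Longrightarrow> apply_mat d M z i = \<mu> * z i" and \<mu>: "Re \<mu> \<ge> 0" and i: "i < n"
  shows "z i = 0"
proof -
  have "(\<Prod>s\<leftarrow>hs. \<mu> - s) \<noteq> 0" using hs \<mu> by (force simp: prod_list_zero_iff)
  then show ?thesis using shifts_apply_eigenvector[OF ev, of i hs] ann[OF i, of z] i nd by simp
qed

text \<open>A row r supported on the first n coordinates sees only the annihilated part, so r p(M) =
  0; but r p(M) is a nonzero multiple of r.\<close>

lemma stable_shifts_left_eigenvector:
  assumes hs: "\<And>s. s \<in> set hs \<Longrightarrow> Re s < 0"
    and ann: "\<And>v i. i < n \<Longrightarrow> shifts_apply d M hs v i = 0" and nd: "n \<le> d"
    and supp: "\<And>i. n \<le> i \<Longrightarrow> i < d \<Longrightarrow> r i = 0"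
    and ev: "\<And>j. j < d \<Longrightarrow> (\<Sum>i<d. r i * M i j) = \<mu> * r j" and \<mu>: "Re \<mu> \<ge> 0" and i: "i < n"
  shows "r i = 0"
proof -
  let ?p = "\<lambda>v. \<Sum>i<d. r i * v i"
  have r_apply: "?p (apply_mat d M v) = \<mu> * ?p v" for v
  proof -
    have "?p (apply_mat d M v) = (\<Sum>j<d. (\<Sum>i<d. r i * M i j) * v j)"
      unfolding apply_mat_def sum_distrib_left sum_distrib_right
      by (subst sum.swap) (simp add: mult_ac)
    then show ?thesis by (simp add: ev sum_distrib_left mult_ac)
  qed
  have r_shifts: "?p (shifts_apply d M ss v) = (\<Prod>s\<leftarrow>ss. \<mu> - s) * ?p v" for ss v
  proof (induction ss)
    case (Cons s ss)
    have "?p (shifts_apply d M (s # ss) v)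
        = ?p (apply_mat d M (shifts_apply d M ss v)) - s * ?p (shifts_apply d M ss v)"
      by (simp add: shift_apply_def[of _ _ s] right_diff_distrib sum_subtractf sum_distrib_left mult_ac)
    then show ?case by (simp add: r_apply Cons algebra_simps)
  qed simp
  have "?p (shifts_apply d M hs v) = 0" for v
    using ann supp by (intro sum.neutral) (metis lessThan_iff mult_zero_left mult_zero_right not_le)
  moreover have "(\<Prod>s\<leftarrow>hs. \<mu> - s) \<noteq> 0" using hs \<mu> by (force simp: prod_list_zero_iff)
  ultimately have "?p v = 0" for v using r_shifts[of hs v] by simp
  from this[of "\<lambda>j. if j = i then 1 else 0"] show ?thesis using i nd
    by (simp add: if_distrib[of "\<lambda>x. _ * x"] cong: if_cong)
qed

text \<open>The roots s need not stay bounded along the sequence: after normalization only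
  |\<mu> - s| \<ge> Re \<mu> matters.\<close>

lemma normalized_shifts_tendsto:
  fixes M :: "nat \<Rightarrow> nat \<Rightarrow> nat \<Rightarrow> complex"
  assumes M: "\<And>i j. i < d \<Longrightarrow> j < d \<Longrightarrow> (\<lambda>k. M k i j) \<longlonglongrightarrow> L i j"
    and ev: "\<And>i. i < d \<Longrightarrow> apply_mat d L z i = \<mu> * z i" and \<mu>: "Re \<mu> > 0"
    and len: "\<And>k. length (hs k) = l" and hs: "\<And>k s. s \<in> set (hs k) \<Longrightarrow> Re s < 0" and i: "i < d"
  shows "(\<lambda>k. shifts_apply d (M k) (hs k) z i / (\<Prod>s\<leftarrow>hs k. \<mu> - s)) \<longlonglongrightarrow> z i"
  using len hs i
proof (induction l arbitrary: hs i)
  case (Suc l)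
  define s where "s k = hd (hs k)" for k
  define ss where "ss k = tl (hs k)" for k
  have hs: "hs k = s k # ss k" for k
    using Suc.prems(1)[of k] by (cases "hs k") (auto simp: s_def ss_def)
  have sk: "Re (s k) < 0" for k using Suc.prems(2)[of "s k" k] by (simp add: hs)
  define W where "W k i = shifts_apply d (M k) (ss k) z i / (\<Prod>s\<leftarrow>ss k. \<mu> - s)" for k i
  have W: "(\<lambda>k. W k i) \<longlonglongrightarrow> z i" if "i < d" for i
    unfolding W_def
  proof (rule Suc.IH)
    show "length (ss k) = l" for k using Suc.prems(1)[of k] by (simp add: hs)
    show "Re r < 0" if "r \<in> set (ss k)" for k r using Suc.prems(2)[of r k] that by (simp add: hs)
  qed (rule that)
  \<comment> \<open>The residual (M k - \<mu>) W tends to (L - \<mu>) z = 0. Writing M - s = (\<mu>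
    - s) + (M - \<mu>), one more normalized factor changes W only by the residual divided by \<mu> -
    s.\<close>
  let ?R = "\<lambda>k. apply_mat d (M k) (W k) i - \<mu> * W k i"
  have "?R \<longlonglongrightarrow> apply_mat d L z i - \<mu> * z i"
    unfolding apply_mat_def using Suc.prems(3) by (intro tendsto_intros M W) auto
  then have R: "?R \<longlonglongrightarrow> 0" using ev Suc.prems(3) by simp
  have gap: "Re \<mu> \<le> norm (\<mu> - s k)" for k
    using complex_Re_le_cmod[of "\<mu> - s k"] sk[of k] by simp
  have pos: "0 < Re \<mu> * norm (\<mu> - s k)" for k
    using less_le_trans[OF \<mu> gap[of k]] \<mu> by (intro mult_pos_pos)
  have "(\<lambda>k. ?R k / (\<mu> - s k)) \<longlonglongrightarrow> 0"
  proof (rule Lim_null_comparison)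
    show "\<forall>\<^sub>F k in sequentially. norm (?R k / (\<mu> - s k)) \<le> norm (?R k) / Re \<mu>"
      unfolding norm_divide using gap pos
      by (intro always_eventually allI divide_left_mono) (simp_all only: mult.commute norm_ge_zero)
    show "(\<lambda>k. norm (?R k) / Re \<mu>) \<longlonglongrightarrow> 0"
      using tendsto_divide[OF tendsto_norm[OF R] tendsto_const] \<mu> by fastforce
  qed
  from tendsto_add[OF W[OF Suc.prems(3)] this]
  have lim: "(\<lambda>k. W k i + ?R k / (\<mu> - s k)) \<longlonglongrightarrow> z i" by simp
  have "shifts_apply d (M k) (hs k) z i / (\<Prod>s\<leftarrow>hs k. \<mu> - s) = W k i + ?R k / (\<mu> - s k)" for k
  proof -
    let ?p = "\<Prod>s\<leftarrow>ss k. \<mu> - s"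
    have "\<mu> \<noteq> s k" using gap[of k] \<mu> by auto
    have eq: "apply_mat d (M k) (W k) i = apply_mat d (M k) (shifts_apply d (M k) (ss k) z) i / ?p"
      unfolding W_def[abs_def] apply_mat_def by (simp add: sum_divide_distrib)
    have "shifts_apply d (M k) (hs k) z i / (\<Prod>s\<leftarrow>hs k. \<mu> - s)
        = (apply_mat d (M k) (W k) i - s k * W k i) / (\<mu> - s k)"
      unfolding hs eq W_def by (simp add: shift_apply_def[of _ _ "s k"] diff_divide_distrib mult.commute)
    also have "\<dots> = W k i + ?R k / (\<mu> - s k)"
      using \<open>\<mu> \<noteq> s k\<close> by (simp add: field_simps)
    finally show ?thesis .
  qed
  then show ?case using lim by simp
qed simp

section \<open>The closed loop of a leader at rest and its follower\<close>

lemma smult_mat_mult_vec: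
  assumes "M \<in> carrier_mat n m" "v \<in> carrier_vec m"
  shows "(k \<cdot>\<^sub>m M) *\<^sub>v v = k \<cdot>\<^sub>v (M *\<^sub>v (v :: real vec))"
  using assms by (auto intro!: eq_vecI)

definition single_edge :: "real \<Rightarrow> nat \<Rightarrow> nat \<Rightarrow> real" where
  "single_edge c i j = (if i = 1 \<and> j = 0 then c else 0)"

locale single_edge_loop =
  fixes n nc q :: nat and A B C Ac Bc Ec Fc G1 G2 Hc :: "real mat"
  assumes A: "A \<in> carrier_mat n n" and B: "B \<in> carrier_mat n 1" and C: "C \<in> carrier_mat 1 n"
    and Ac: "Ac \<in> carrier_mat nc nc" and Bc: "Bc \<in> carrier_mat nc 1" and Ec: "Ec \<in> carrier_mat nc q"
    and Fc: "Fc \<in> carrier_mat 1 nc" and G1: "G1 \<in> carrier_mat 1 1" and G2: "G2 \<in> carrier_mat 1 q"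
    and Hc: "Hc \<in> carrier_mat q nc"
begin

text \<open>The closed loop of a follower with one edge of weight c from an agent at rest.\<close>

definition follower_mat :: "real \<Rightarrow> real mat" where
  "follower_mat c = four_block_mat (A + B * (c \<cdot>\<^sub>m (G1 * C))) (B * (Fc + c \<cdot>\<^sub>m (G2 * Hc)))
     (c \<cdot>\<^sub>m (Bc * C)) (Ac + c \<cdot>\<^sub>m (Ec * Hc))"

lemma follower_mat_carrier: "follower_mat c \<in> carrier_mat (n + nc) (n + nc)"
  unfolding follower_mat_def using A B C Ac Bc Ec Fc G1 G2 Hc by (intro four_block_carrier_mat) auto

lemma follower_mat_mult_vec:
  assumes x: "x \<in> carrier_vec n" and y: "y \<in> carrier_vec nc"
  shows "follower_mat c *\<^sub>v (x @\<^sub>v y)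
    = (A *\<^sub>v x + B *\<^sub>v (Fc *\<^sub>v y + G1 *\<^sub>v (C *\<^sub>v (c \<cdot>\<^sub>v x)) + G2 *\<^sub>v (Hc *\<^sub>v (c \<cdot>\<^sub>v y))))
      @\<^sub>v (Ac *\<^sub>v y + Bc *\<^sub>v (C *\<^sub>v (c \<cdot>\<^sub>v x)) + Ec *\<^sub>v (Hc *\<^sub>v (c \<cdot>\<^sub>v y)))"
proof -
  define u where "u = C *\<^sub>v x"
  define h where "h = Hc *\<^sub>v y"
  have u: "u \<in> carrier_vec 1" and h: "h \<in> carrier_vec q" using C Hc x y by (auto simp: u_def h_def)
  have cu: "C *\<^sub>v (c \<cdot>\<^sub>v x) = c \<cdot>\<^sub>v u" and ch: "Hc *\<^sub>v (c \<cdot>\<^sub>v y) = c \<cdot>\<^sub>v h"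
    using C Hc x y by (auto simp: u_def h_def mult_mat_vec)
  have 1: "(A + B * (c \<cdot>\<^sub>m (G1 * C))) *\<^sub>v x = A *\<^sub>v x + B *\<^sub>v (G1 *\<^sub>v (c \<cdot>\<^sub>v u))"
  proof -
    have "(B * (c \<cdot>\<^sub>m (G1 * C))) *\<^sub>v x = B *\<^sub>v (c \<cdot>\<^sub>v (G1 *\<^sub>v u))"
      using B G1 C x unfolding u_def
      by (subst assoc_mult_mat_vec[of _ n 1 _ n]) (auto simp: smult_mat_mult_vec[of _ "Suc 0" n])
    also have "c \<cdot>\<^sub>v (G1 *\<^sub>v u) = G1 *\<^sub>v (c \<cdot>\<^sub>v u)" using G1 u by (simp add: mult_mat_vec)
    finally show ?thesis using A B G1 C x by (subst add_mult_distrib_mat_vec[of _ n n]) auto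
  qed
  have 2: "(B * (Fc + c \<cdot>\<^sub>m (G2 * Hc))) *\<^sub>v y = B *\<^sub>v (Fc *\<^sub>v y + G2 *\<^sub>v (c \<cdot>\<^sub>v h))"
  proof -
    have "(Fc + c \<cdot>\<^sub>m (G2 * Hc)) *\<^sub>v y = Fc *\<^sub>v y + c \<cdot>\<^sub>v (G2 *\<^sub>v h)"
      using Fc G2 Hc y unfolding h_def
      by (subst add_mult_distrib_mat_vec[of _ 1 nc]) (auto simp: smult_mat_mult_vec[of _ "Suc 0" nc])
    also have "c \<cdot>\<^sub>v (G2 *\<^sub>v h) = G2 *\<^sub>v (c \<cdot>\<^sub>v h)" using G2 h by (simp add: mult_mat_vec)
    finally show ?thesis using B Fc G2 Hc y by (subst assoc_mult_mat_vec[of _ n 1 _ nc]) auto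
  qed
  have 3: "(c \<cdot>\<^sub>m (Bc * C)) *\<^sub>v x = Bc *\<^sub>v (c \<cdot>\<^sub>v u)"
    using Bc C x u by (simp add: smult_mat_mult_vec[of _ nc n] mult_mat_vec[OF Bc] u_def)
  have 4: "(Ac + c \<cdot>\<^sub>m (Ec * Hc)) *\<^sub>v y = Ac *\<^sub>v y + Ec *\<^sub>v (c \<cdot>\<^sub>v h)"
  proof -
    have "(c \<cdot>\<^sub>m (Ec * Hc)) *\<^sub>v y = Ec *\<^sub>v (c \<cdot>\<^sub>v h)"
      using Ec Hc y h by (simp add: smult_mat_mult_vec[of _ nc nc] mult_mat_vec[OF Ec] h_def)
    then show ?thesis using Ac Ec Hc y by (subst add_mult_distrib_mat_vec[of _ nc nc]) auto
  qed
  have carr: "A *\<^sub>v x \<in> carrier_vec n" "G1 *\<^sub>v (c \<cdot>\<^sub>v u) \<in> carrier_vec 1" "Fc *\<^sub>v y \<in> carrier_vec 1"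
    "G2 *\<^sub>v (c \<cdot>\<^sub>v h) \<in> carrier_vec 1" "Ac *\<^sub>v y \<in> carrier_vec nc" "Bc *\<^sub>v (c \<cdot>\<^sub>v u) \<in> carrier_vec nc"
    "Ec *\<^sub>v (c \<cdot>\<^sub>v h) \<in> carrier_vec nc"
    using A G1 Fc G2 Ac Bc Ec x y u h by auto
  have "follower_mat c *\<^sub>v (x @\<^sub>v y)
      = ((A + B * (c \<cdot>\<^sub>m (G1 * C))) *\<^sub>v x + (B * (Fc + c \<cdot>\<^sub>m (G2 * Hc))) *\<^sub>v y)
        @\<^sub>v ((c \<cdot>\<^sub>m (Bc * C)) *\<^sub>v x + (Ac + c \<cdot>\<^sub>m (Ec * Hc)) *\<^sub>v y)"
    unfolding follower_mat_def using A B C Ac Bc Ec Fc G1 G2 Hc x y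
    by (intro four_block_mat_mult_vec) auto
  also have "(A + B * (c \<cdot>\<^sub>m (G1 * C))) *\<^sub>v x + (B * (Fc + c \<cdot>\<^sub>m (G2 * Hc))) *\<^sub>v y
      = A *\<^sub>v x + B *\<^sub>v (Fc *\<^sub>v y + G1 *\<^sub>v (c \<cdot>\<^sub>v u) + G2 *\<^sub>v (c \<cdot>\<^sub>v h))"
    unfolding 1 2 using carr B
    by (auto intro!: eq_vecI simp: mult_add_distrib_mat_vec[OF B] simp del: index_mult_mat_vec)
  also have "(c \<cdot>\<^sub>m (Bc * C)) *\<^sub>v x + (Ac + c \<cdot>\<^sub>m (Ec * Hc)) *\<^sub>v y
      = Ac *\<^sub>v y + Bc *\<^sub>v (c \<cdot>\<^sub>v u) + Ec *\<^sub>v (c \<cdot>\<^sub>v h)"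
    unfolding 3 4 using carr Ac Bc Ec by (auto intro!: eq_vecI simp del: index_mult_mat_vec)
  finally show ?thesis unfolding cu ch .
qed

text \<open>In the agent rows everything added to A passes through B. A left eigenvector of A that
  annihilates B, padded with zeros, therefore stays one for the closed loop.\<close>

lemma follower_mat_input_structure:
  assumes "i < n" "j < n + nc"
  shows "follower_mat c $$ (i, j) = (if j < n then A $$ (i, j) else 0)
    + B $$ (i, 0) * (if j < n then (c \<cdot>\<^sub>m (G1 * C)) $$ (0, j) else (Fc + c \<cdot>\<^sub>m (G2 * Hc)) $$ (0, j - n))"
proof -
  have "(B * (c \<cdot>\<^sub>m (G1 * C))) $$ (i, j) = B $$ (i, 0) * (c \<cdot>\<^sub>m (G1 * C)) $$ (0, j)" if "j < n"
    using assms that B G1 C by (subst index_mult_mat_sum[of _ n 1 _ n]) auto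
  moreover have "(B * (Fc + c \<cdot>\<^sub>m (G2 * Hc))) $$ (i, j - n)
      = B $$ (i, 0) * (Fc + c \<cdot>\<^sub>m (G2 * Hc)) $$ (0, j - n)" if "\<not> j < n"
    using assms that B Fc G2 Hc by (subst index_mult_mat_sum[of _ n 1 _ nc]) auto
  ultimately show ?thesis
    using assms A B C Ac Ec Fc G1 G2 Hc
    by (auto simp: follower_mat_def simp del: index_mult_mat(1) index_smult_mat(1))
qed

text \<open>In the agent columns everything added to A passes through C and carries the factor c. A
  padded right eigenvector of A thus survives if C annihilates it, or if c = 0.\<close>

lemma follower_mat_output_structure:
  assumes "i < n + nc" "j < n"
  shows "follower_mat c $$ (i, j) = (if i < n then A $$ (i, j) else 0)
    + (if i < n then c * (B * G1) $$ (i, 0) else c * Bc $$ (i - n, 0)) * C $$ (0, j)"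
proof -
  have "B * (c \<cdot>\<^sub>m (G1 * C)) = c \<cdot>\<^sub>m ((B * G1) * C)"
    using B G1 C by (simp add: mult_smult_distrib[of _ n 1 _ n] assoc_mult_mat[of _ n 1 _ 1 _ n])
  moreover have "((B * G1) * C) $$ (i, j) = (B * G1) $$ (i, 0) * C $$ (0, j)" if "i < n"
    using assms that B G1 C by (subst index_mult_mat_sum[of _ n 1 _ n]) auto
  moreover have "(Bc * C) $$ (i - n, j) = Bc $$ (i - n, 0) * C $$ (0, j)" if "\<not> i < n"
    using assms that Bc C by (subst index_mult_mat_sum[of _ nc 1 _ n]) auto
  ultimately show ?thesis
    using assms A B C Ac Bc Ec Fc G1 G2 Hc
    by (auto simp: follower_mat_def simp del: index_mult_mat(1))
qed

lemma follower_mat_tendsto: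
  assumes "i < n + nc" "j < n + nc" and c: "c \<longlonglongrightarrow> 0"
  shows "(\<lambda>k. follower_mat (c k) $$ (i, j)) \<longlonglongrightarrow> follower_mat 0 $$ (i, j)"
proof -
  have Bsum: "(B * (Fc + c \<cdot>\<^sub>m (G2 * Hc))) $$ (i, j - n)
      = B $$ (i, 0) * (Fc $$ (0, j - n) + c * (G2 * Hc) $$ (0, j - n))" if "i < n" "\<not> j < n" for c
    using assms that B Fc G2 Hc
    by (subst index_mult_mat_sum[of _ n 1 _ nc]) (auto simp del: index_mult_mat(1))
  have e: "\<exists>p r. \<forall>c. follower_mat c $$ (i, j) = p + c * r"
  proof (cases "i < n"; cases "j < n")
    assume ij: "i < n" "\<not> j < n"
    have "follower_mat c $$ (i, j)
        = B $$ (i, 0) * Fc $$ (0, j - n) + c * (B $$ (i, 0) * (G2 * Hc) $$ (0, j - n))" for c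
      using assms(1,2) ij A B C Ac Bc Ec Fc G1 G2 Hc Bsum[OF ij]
      by (simp add: follower_mat_def algebra_simps del: index_mult_mat(1))
    then show ?thesis by blast
  next
    assume ij: "\<not> i < n" "\<not> j < n"
    have "follower_mat c $$ (i, j) = Ac $$ (i - n, j - n) + c * (Ec * Hc) $$ (i - n, j - n)" for c
      using assms(1,2) ij A B C Ac Bc Ec Fc G1 G2 Hc
      by (simp add: follower_mat_def del: index_mult_mat(1))
    then show ?thesis by blast
  next
    assume ij: "i < n" "j < n"
    show ?thesis
      using follower_mat_output_structure[OF assms(1) ij(2)] ij by (auto simp: mult.assoc)
  next
    assume ij: "\<not> i < n" "j < n"
    show ?thesis
      using follower_mat_output_structure[OF assms(1) ij(2)] ij
      by (intro exI[of _ 0] exI[of _ "Bc $$ (i - n, 0) * C $$ (0, j)"]) auto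
  qed
  then obtain p r where e: "\<And>c. follower_mat c $$ (i, j) = p + c * r" by blast
  show ?thesis unfolding e using c by (intro tendsto_intros)
qed

text \<open>The Laplacian row of node 0 vanishes, so the zero trajectory is admissible for the
  leader. Synchronization of this solution means that the first n coordinates of z tend to
  zero.\<close>

lemma follower_solution:
  assumes z: "\<And>i t. i < n + nc \<Longrightarrow> t \<ge> 0 \<Longrightarrow>
      (z i has_real_derivative (follower_mat c *\<^sub>v vec (n + nc) (\<lambda>j. z j t)) $ i) (at t within {0..})"
  shows "closed_loop_solution A B C Ac Bc Ec Fc G1 G2 Hc 2 (single_edge c)
    (\<lambda>i t. if i = 0 then 0\<^sub>v n else vec n (\<lambda>k. z k t))
    (\<lambda>i t. if i = 0 then 0\<^sub>v nc else vec nc (\<lambda>k. z (n + k) t))"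
    (is "closed_loop_solution _ _ _ _ _ _ _ _ _ _ _ _ ?x ?y")
  unfolding closed_loop_solution_def Let_def
proof (intro allI impI conjI)
  fix i :: nat and t :: real assume t: "t \<ge> 0" and i: "i < 2"
  show "?x i t \<in> carrier_vec (dim_row A)" "?y i t \<in> carrier_vec (dim_row Ac)" using A Ac by auto
  have two: "{..<2::nat} = {0, 1}" by auto
  have lap: "(\<Sum>j<2. laplacian 2 (single_edge c) i j * v j) = (if i = 0 then 0 else c * (v 1 - v 0))"
    for v :: "nat \<Rightarrow> real"
    using i by (auto simp: two laplacian_def single_edge_def algebra_simps)
  let ?X = "vec n (\<lambda>k. z k t)" and ?Y = "vec nc (\<lambda>k. z (n + k) t)"
  have zeta: "net_sum 2 (single_edge c) C (\<lambda>j. ?x j t) i = C *\<^sub>v (if i = 0 then 0\<^sub>v n else c \<cdot>\<^sub>v ?X)"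
    using C by (subst net_sum_eq_mult_mat_vec[of _ 1 n]) (auto simp: lap intro!: arg_cong[of _ _ "(*\<^sub>v) C"] eq_vecI)
  have zetah: "net_sum 2 (single_edge c) Hc (\<lambda>j. ?y j t) i = Hc *\<^sub>v (if i = 0 then 0\<^sub>v nc else c \<cdot>\<^sub>v ?Y)"
    using Hc by (subst net_sum_eq_mult_mat_vec[of _ q nc]) (auto simp: lap intro!: arg_cong[of _ _ "(*\<^sub>v) Hc"] eq_vecI)
  let ?u = "Fc *\<^sub>v ?y i t + G1 *\<^sub>v net_sum 2 (single_edge c) C (\<lambda>j. ?x j t) i
    + G2 *\<^sub>v net_sum 2 (single_edge c) Hc (\<lambda>j. ?y j t) i"
  let ?dx = "A *\<^sub>v ?x i t + B *\<^sub>v ?u"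
  let ?dy = "Ac *\<^sub>v ?y i t + Bc *\<^sub>v net_sum 2 (single_edge c) C (\<lambda>j. ?x j t) i
    + Ec *\<^sub>v net_sum 2 (single_edge c) Hc (\<lambda>j. ?y j t) i"
  have "has_vderiv (?x i) ?dx t \<and> has_vderiv (?y i) ?dy t"
  proof (cases "i = 0")
    case True
    have zero: "M *\<^sub>v 0\<^sub>v m = 0\<^sub>v l" if "M \<in> carrier_mat l m" for M :: "real mat" and l m
      using that by (auto intro!: eq_vecI)
    have "?dx = 0\<^sub>v n" "?dy = 0\<^sub>v nc"
      using True unfolding zeta zetah
      by (simp_all add: zero[OF A] zero[OF B] zero[OF C] zero[OF Ac] zero[OF Bc] zero[OF Ec] zero[OF Fc]
          zero[OF G1] zero[OF G2] zero[OF Hc] del: One_nat_def)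
    then show ?thesis using True by (simp add: has_vderiv_def)
  next
    case False
    have "vec (n + nc) (\<lambda>j. z j t) = ?X @\<^sub>v ?Y" by (auto intro!: eq_vecI)
    then have eq: "follower_mat c *\<^sub>v vec (n + nc) (\<lambda>j. z j t) = ?dx @\<^sub>v ?dy"
      using False unfolding zeta zetah by (simp add: follower_mat_mult_vec)
    have dim: "dim_vec ?dx = n" "dim_vec ?dy = nc" using B Ec by auto
    have "(z k has_real_derivative ?dx $ k) (at t within {0..})" if "k < n" for k
      using z[of k t] that t dim unfolding eq by (simp only: index_append_vec) simp
    moreover have "(z (n + k) has_real_derivative ?dy $ k) (at t within {0..})" if "k < nc" for k
      using z[of "n + k" t] that t dim unfolding eq by (simp only: index_append_vec) simp
    ultimately show ?thesis unfolding has_vderiv_def dim using False by simp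
  qed
  then show "has_vderiv (?x i) ?dx t" "has_vderiv (?y i) ?dy t" by auto
qed

lemma single_edge_graph:
  assumes "c > 0"
  shows "is_weighted_digraph 2 (single_edge c)" "has_directed_spanning_tree 2 (single_edge c)"
proof -
  show "is_weighted_digraph 2 (single_edge c)" using assms by (auto simp: is_weighted_digraph_def single_edge_def)
  have "dedge 2 (single_edge c) 0 1" using assms by (simp add: dedge_def single_edge_def)
  then have "(dedge 2 (single_edge c))\<^sup>*\<^sup>* 0 i" if "i < 2" for i
    using that by (cases "i = 0") (auto simp: less_2_cases_iff)
  then show "has_directed_spanning_tree 2 (single_edge c)"
    unfolding has_directed_spanning_tree_def by (intro exI[of _ 0]) auto
qed

end

section \<open>What synchronization forces on the plant\<close>

locale synchronizing_loop = single_edge_loop +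
  assumes sync: "\<And>N a x xc i j k.
    is_weighted_digraph N a \<Longrightarrow> has_directed_spanning_tree N a \<Longrightarrow>
    closed_loop_solution A B C Ac Bc Ec Fc G1 G2 Hc N a x xc \<Longrightarrow>
    i < N \<Longrightarrow> j < N \<Longrightarrow> k < n \<Longrightarrow> ((\<lambda>t. vec_index (x i t) k - vec_index (x j t) k) \<longlongrightarrow> 0) at_top"
begin

abbreviation cfollower :: "real \<Rightarrow> nat \<Rightarrow> nat \<Rightarrow> complex" where
  "cfollower c i j \<equiv> complex_of_real (follower_mat c $$ (i, j))"

lemma real_follower_tendsto_zero:
  assumes c: "c > 0"
    and z: "\<And>i t. i < n + nc \<Longrightarrow> t \<ge> 0 \<Longrightarrow>
      (z i has_real_derivative (\<Sum>j<n + nc. follower_mat c $$ (i, j) * z j t)) (at t within {0..})"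
    and k: "k < n"
  shows "(z k \<longlongrightarrow> 0) at_top"
proof -
  have "(z i has_real_derivative (follower_mat c *\<^sub>v vec (n + nc) (\<lambda>j. z j t)) $ i) (at t within {0..})"
    if "i < n + nc" "t \<ge> 0" for i t
    using z[OF that] that follower_mat_carrier[of c]
    by (subst index_mult_mat_vec_sum[of _ "n + nc" "n + nc"]) auto
  from sync[OF single_edge_graph[OF c] follower_solution[OF this], of 1 0 k] k
  show ?thesis by simp
qed

text \<open>Synchronization speaks of real trajectories. The closed loop is real, so real and
  imaginary parts of a complex solution are themselves solutions.\<close>

lemma follower_tendsto_zero:
  assumes c: "c > 0" and X: "solves_linear_ode (n + nc) (cfollower c) (\<lambda>_ _. 0) X" and k: "k < n"
  shows "(X k \<longlongrightarrow> 0) at_top"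
proof -
  have D: "(X i has_vector_derivative (\<Sum>j<n + nc. cfollower c i j * X j t)) (at t within {0..})"
    if "i < n + nc" "t \<ge> 0" for i t
    using X that by (simp add: solves_linear_ode_def apply_mat_def)
  have "((\<lambda>t. Re (X k t)) \<longlongrightarrow> 0) at_top"
  proof (rule real_follower_tendsto_zero[OF c _ k])
    show "((\<lambda>t. Re (X i t)) has_real_derivative (\<Sum>j<n + nc. follower_mat c $$ (i, j) * Re (X j t))) (at t within {0..})"
      if "i < n + nc" "t \<ge> 0" for i t
      using bounded_linear.has_vector_derivative[OF bounded_linear_Re D[OF that]]
      by (simp add: has_real_derivative_iff_has_vector_derivative)
  qed
  moreover have "((\<lambda>t. Im (X k t)) \<longlongrightarrow> 0) at_top"
  proof (rule real_follower_tendsto_zero[OF c _ k])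
    show "((\<lambda>t. Im (X i t)) has_real_derivative (\<Sum>j<n + nc. follower_mat c $$ (i, j) * Im (X j t))) (at t within {0..})"
      if "i < n + nc" "t \<ge> 0" for i t
      using bounded_linear.has_vector_derivative[OF bounded_linear_Im D[OF that]]
      by (simp add: has_real_derivative_iff_has_vector_derivative)
  qed
  ultimately show ?thesis by (simp add: tendsto_complex_iff)
qed

text \<open>Only the first n coordinates are annihilated, as the protocol state may diverge unseen.
  The number of factors is the same for every c, which makes the passage to c = 0 possible.\<close>

lemma follower_stable_shifts:
  assumes c: "c > 0"
  obtains hs where "length hs = n + nc" "\<And>s. s \<in> set hs \<Longrightarrow> Re s < 0"
    "\<And>v i. i < n \<Longrightarrow> shifts_apply (n + nc) (cfollower c) hs v i = 0"
proof -
  obtain ss where ss: "length ss = n + nc" "annihilated_by (n + nc) (cfollower c) ss"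
    using annihilated_by_eigenvalues_real[OF follower_mat_carrier] by blast
  obtain hs where "length hs = length ss" "\<And>s. s \<in> set hs \<Longrightarrow> Re s < 0"
    "\<And>v i. i < n \<Longrightarrow> shifts_apply (n + nc) (cfollower c) hs v i = 0"
    using stable_shifts_exist[where d = "n + nc" and M = "cfollower c" and n = n and ss = ss]
      follower_tendsto_zero[OF c] ss(2) by auto
  then show ?thesis using ss(1) that by simp
qed

text \<open>An uncontrollable mode with nonnegative real part would be a left eigenvector of the
  closed loop living on the agent coordinates, which the stable product excludes. Weight 1 is an
  arbitrary positive choice.\<close>

lemma stabilizable_of_sync: "stabilizable A B"
proof (rule stabilizable_if_hautus[OF A B])
  let ?A = "map_mat complex_of_real A" and ?B = "map_mat complex_of_real B"
  obtain hs where hs: "\<And>s. s \<in> set hs \<Longrightarrow> Re s < 0"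
    "\<And>v i. i < n \<Longrightarrow> shifts_apply (n + nc) (cfollower 1) hs v i = 0"
    using follower_stable_shifts[of 1] by (metis less_numeral_extra(1))
  show "hautus_controllable n ?A ?B"
    unfolding hautus_controllable_def
  proof (intro ballI allI impI notI)
    fix w \<mu> assume w: "w \<in> carrier_mat 1 n" and wB: "(w * ?B) $$ (0, 0) = 0"
      and ev: "w \<noteq> 0\<^sub>m 1 n \<and> w * ?A = \<mu> \<cdot>\<^sub>m w \<and> 0 \<le> Re \<mu>"
    define r where "r i = (if i < n then w $$ (0, i) else 0)" for i
    have rA: "(\<Sum>i<n. w $$ (0, i) * complex_of_real (A $$ (i, j))) = \<mu> * w $$ (0, j)" if "j < n" for j
    proof -
      have "(w * ?A) $$ (0, j) = (\<Sum>i<n. w $$ (0, i) * complex_of_real (A $$ (i, j)))"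
        using w A that by (subst index_mult_mat_sum[of _ 1 n _ n]) auto
      then show ?thesis using ev w that by simp
    qed
    have rB: "(\<Sum>i<n. w $$ (0, i) * complex_of_real (B $$ (i, 0))) = 0"
      using wB w B by (subst (asm) index_mult_mat_sum[of _ 1 n _ 1]) auto
    have split: "(\<Sum>i<n + nc. r i * g i) = (\<Sum>i<n. w $$ (0, i) * g i)" for g
      by (intro sum.mono_neutral_cong_right) (auto simp: r_def)
    have "r i = 0" if "i < n" for i
    proof (rule stable_shifts_left_eigenvector[OF hs le_add1 _ _ _ that, where r = r and \<mu> = \<mu>])
      fix j assume j: "j < n + nc"
      let ?R = "if j < n then (1 \<cdot>\<^sub>m (G1 * C)) $$ (0, j) else (Fc + 1 \<cdot>\<^sub>m (G2 * Hc)) $$ (0, j - n)"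
      have "(\<Sum>i<n. w $$ (0, i) * cfollower 1 i j)
          = (\<Sum>i<n. w $$ (0, i) * (if j < n then complex_of_real (A $$ (i, j)) else 0)
              + w $$ (0, i) * complex_of_real (B $$ (i, 0)) * complex_of_real ?R)"
        using j by (intro sum.cong refl) (simp add: follower_mat_input_structure algebra_simps)
      also have "\<dots> = (if j < n then \<mu> * w $$ (0, j) else 0)"
        using rA[of j] rB by (simp add: sum.distrib flip: sum_distrib_right)
      finally show "(\<Sum>i<n + nc. r i * cfollower 1 i j) = \<mu> * r j"
        unfolding split by (simp add: r_def)
    qed (use ev in \<open>auto simp: r_def\<close>)
    then have "w = 0\<^sub>m 1 n" using w by (auto intro!: eq_matI simp: r_def)
    then show False using ev by simp
  qed
qed

text \<open>The disjunction in \<open>zC\<close> covers two uses: unobservable modes at weight 1,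
  and all modes of A in the uncoupled limit c = 0.\<close>

lemma apply_cfollower_extended:
  assumes i: "i < n + nc"
    and z: "\<And>j. n \<le> j \<Longrightarrow> z j = 0"
    and zA: "\<And>i. i < n \<Longrightarrow> (\<Sum>j<n. complex_of_real (A $$ (i, j)) * z j) = \<mu> * z i"
    and zC: "c = 0 \<or> (\<Sum>j<n. complex_of_real (C $$ (0, j)) * z j) = 0"
  shows "apply_mat (n + nc) (cfollower c) z i = \<mu> * z i"
proof -
  define S where "S = complex_of_real (if i < n then c * (B * G1) $$ (i, 0) else c * Bc $$ (i - n, 0))"
  have "apply_mat (n + nc) (cfollower c) z i = (\<Sum>j<n. cfollower c i j * z j)"
    unfolding apply_mat_def using z by (intro sum.mono_neutral_right) auto
  also have "\<dots> = (\<Sum>j<n. (if i < n then complex_of_real (A $$ (i, j)) * z j else 0)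
      + S * (complex_of_real (C $$ (0, j)) * z j))"
    using i unfolding S_def
    by (intro sum.cong refl) (simp add: follower_mat_output_structure algebra_simps del: index_mult_mat(1))
  also have "\<dots> = (if i < n then \<mu> * z i else 0)"
    using zA[of i] zC by (auto simp: sum.distrib S_def simp flip: sum_distrib_left)
  also have "\<dots> = \<mu> * z i" using z[of i] by auto
  finally show ?thesis .
qed

text \<open>By duality the feedback construction is applied to the transposes of A and C. A left
  eigenvector of the transpose of A is a right eigenvector of A, and the transposed gain serves as
  output injection.\<close>

lemma detectable_of_sync: "detectable C A"
proof -
  let ?A = "map_mat complex_of_real (transpose_mat A)" and ?C = "map_mat complex_of_real (transpose_mat C)"
  have At: "transpose_mat A \<in> carrier_mat n n" and Ct: "transpose_mat C \<in> carrier_mat n 1" using A C by auto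
  obtain hs where hs: "\<And>s. s \<in> set hs \<Longrightarrow> Re s < 0"
    "\<And>v i. i < n \<Longrightarrow> shifts_apply (n + nc) (cfollower 1) hs v i = 0"
    using follower_stable_shifts[of 1] by (metis less_numeral_extra(1))
  have "hautus_controllable n ?A ?C"
    unfolding hautus_controllable_def
  proof (intro ballI allI impI notI)
    fix w \<mu> assume w: "w \<in> carrier_mat 1 n" and wC: "(w * ?C) $$ (0, 0) = 0"
      and ev: "w \<noteq> 0\<^sub>m 1 n \<and> w * ?A = \<mu> \<cdot>\<^sub>m w \<and> 0 \<le> Re \<mu>"
    define z where "z i = (if i < n then w $$ (0, i) else 0)" for i
    have zA: "(\<Sum>j<n. complex_of_real (A $$ (i, j)) * z j) = \<mu> * z i" if "i < n" for i
    proof -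
      have "(w * ?A) $$ (0, i) = (\<Sum>j<n. w $$ (0, j) * complex_of_real (A $$ (i, j)))"
        using w A that by (subst index_mult_mat_sum[of _ 1 n _ n]) auto
      then show ?thesis using ev w that by (simp add: z_def mult.commute)
    qed
    have zC: "(\<Sum>j<n. complex_of_real (C $$ (0, j)) * z j) = 0"
      using wC w C by (subst (asm) index_mult_mat_sum[of _ 1 n _ 1]) (auto simp: z_def mult.commute)
    have "z i = 0" if "i < n" for i
    proof (rule stable_shifts_right_eigenvector[OF hs le_add1 _ _ that, where \<mu> = \<mu>])
      show "apply_mat (n + nc) (cfollower 1) z i = \<mu> * z i" if "i < n + nc" for i
        using that by (intro apply_cfollower_extended zA disjI2 zC) (auto simp: z_def)
    qed (use ev in auto)
    then have "w = 0\<^sub>m 1 n" using w by (auto intro!: eq_matI simp: z_def)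
    then show False using ev by simp
  qed
  from stabilizable_if_hautus[OF At Ct this] obtain F where F: "F \<in> carrier_mat 1 n"
    and hF: "hurwitz (transpose_mat A + transpose_mat C * F)"
    using A C by (auto simp: stabilizable_def)
  let ?K = "transpose_mat F"
  have AKC: "A + ?K * C \<in> carrier_mat n n" using A C F by auto
  have "transpose_mat A + transpose_mat C * F = transpose_mat (A + ?K * C)"
    using A C F by (subst transpose_add[of _ n n]) (auto simp: transpose_mult[of _ n 1 _ n])
  moreover have "map_mat complex_of_real (transpose_mat (A + ?K * C))
      = transpose_mat (map_mat complex_of_real (A + ?K * C))"
    by (auto intro!: eq_matI)
  ultimately have "hurwitz (A + ?K * C)"
    using hF AKC by (simp add: hurwitz_def eigenvalue_root_char_poly[of _ n] char_poly_transpose_mat[of _ n])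
  then show ?thesis using A C F by (auto simp: detectable_def intro!: bexI[of _ ?K])
qed

text \<open>The weights 1 / (k + 1) stay positive, as synchronization requires a spanning tree. The
  normalized products applied to z vanish on the agent coordinates for every k and yet converge to
  z. Strict positivity of Re \<mu> gives the uniform distance from the stable roots.\<close>

lemma eigs_closed_left_of_sync: "eigs_closed_left A"
  unfolding eigs_closed_left_def
proof (intro allI impI)
  fix \<mu> assume "eigenvalue (map_mat complex_of_real A) \<mu>"
  then obtain v where v: "v \<in> carrier_vec n" "v \<noteq> 0\<^sub>v n" "map_mat complex_of_real A *\<^sub>v v = \<mu> \<cdot>\<^sub>v v"
    using A by (auto simp: eigenvalue_def eigenvector_def)
  define z where "z i = (if i < n then vec_index v i else 0)" for i
  have zA: "(\<Sum>j<n. complex_of_real (A $$ (i, j)) * z j) = \<mu> * z i" if "i < n" for i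
  proof -
    have "(\<Sum>j<n. complex_of_real (A $$ (i, j)) * z j) = vec_index (map_mat complex_of_real A *\<^sub>v v) i"
      using A v that by (subst index_mult_mat_vec_sum[of _ n n]) (auto simp: z_def)
    then show ?thesis using v that by (simp add: z_def)
  qed
  show "Re \<mu> \<le> 0"
  proof (rule ccontr)
    assume "\<not> Re \<mu> \<le> 0"
    then have \<mu>: "Re \<mu> > 0" by simp
    define c where "c k = 1 / real (Suc k)" for k
    have c: "c k > 0" for k by (simp add: c_def)
    have c_lim: "c \<longlonglongrightarrow> 0"
      using LIMSEQ_inverse_real_of_nat by (simp add: c_def[abs_def] inverse_eq_divide)
    have "\<forall>k. \<exists>hs. length hs = n + nc \<and> (\<forall>s\<in>set hs. Re s < 0)
        \<and> (\<forall>v. \<forall>i<n. shifts_apply (n + nc) (cfollower (c k)) hs v i = 0)"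
      using follower_stable_shifts[OF c] by metis
    then obtain hs where hs: "\<And>k. length (hs k) = n + nc" "\<And>k s. s \<in> set (hs k) \<Longrightarrow> Re s < 0"
      "\<And>k v i. i < n \<Longrightarrow> shifts_apply (n + nc) (cfollower (c k)) (hs k) v i = 0"
      by metis
    have "z i = 0" if "i < n" for i
    proof -
      have "(\<lambda>k. shifts_apply (n + nc) (cfollower (c k)) (hs k) z i / (\<Prod>s\<leftarrow>hs k. \<mu> - s)) \<longlonglongrightarrow> z i"
      proof (rule normalized_shifts_tendsto[OF _ _ \<mu> hs(1,2)])
        show "(\<lambda>k. cfollower (c k) i j) \<longlonglongrightarrow> cfollower 0 i j" if "i < n + nc" "j < n + nc" for i j
          by (intro tendsto_of_real follower_mat_tendsto that c_lim)
        show "apply_mat (n + nc) (cfollower 0) z i = \<mu> * z i" if "i < n + nc" for i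
          using that zA by (intro apply_cfollower_extended) (auto simp: z_def)
      qed (use that in auto)
      then show ?thesis unfolding hs(3)[OF that] by (simp add: LIMSEQ_const_iff)
    qed
    then have "v = 0\<^sub>v n" using v by (auto intro!: eq_vecI simp: z_def)
    then show False using v by simp
  qed
qed

end

theorem theorem5:
  fixes A B C :: "real mat" and n :: nat
  assumes "A \<in> carrier_mat n n" and "B \<in> carrier_mat n 1" and "C \<in> carrier_mat 1 n"
  shows "scale_free_sync_solvable A B C \<longleftrightarrow>
           hurwitz A \<or> (stabilizable A B \<and> detectable C A \<and> eigs_closed_left A)"
proof
  assume "scale_free_sync_solvable A B C"
  then show "hurwitz A \<or> (stabilizable A B \<and> detectable C A \<and> eigs_closed_left A)"
    unfolding scale_free_sync_solvable_def
  proof (elim exE conjE)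
    fix nc q Ac Bc Ec Fc G1 G2 Hc
    assume carr: "Ac \<in> carrier_mat nc nc" "Bc \<in> carrier_mat nc (dim_row C)" "Ec \<in> carrier_mat nc q"
      "Fc \<in> carrier_mat (dim_col B) nc" "G1 \<in> carrier_mat (dim_col B) (dim_row C)"
      "G2 \<in> carrier_mat (dim_col B) q" "Hc \<in> carrier_mat q nc"
      and sync: "\<forall>N a x xc.
          is_weighted_digraph N a \<and> has_directed_spanning_tree N a \<and>
          closed_loop_solution A B C Ac Bc Ec Fc G1 G2 Hc N a x xc \<longrightarrow>
          (\<forall>i<N. \<forall>j<N. \<forall>k<dim_row A.
             ((\<lambda>t. vec_index (x i t) k - vec_index (x j t) k) \<longlongrightarrow> 0) at_top)"
    have loop: "single_edge_loop n nc q A B C Ac Bc Ec Fc G1 G2 Hc"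
      using assms carr by (simp add: single_edge_loop_def)
    interpret synchronizing_loop n nc q A B C Ac Bc Ec Fc G1 G2 Hc
    proof (intro synchronizing_loop.intro loop synchronizing_loop_axioms.intro)
      show "((\<lambda>t. vec_index (x i t) k - vec_index (x j t) k) \<longlongrightarrow> 0) at_top"
        if "is_weighted_digraph N a" "has_directed_spanning_tree N a"
          "closed_loop_solution A B C Ac Bc Ec Fc G1 G2 Hc N a x xc" "i < N" "j < N" "k < n"
        for N a x xc i j k
        using sync[unfolded carrier_matD(1)[OF assms(1)], rule_format, OF conjI, OF _ conjI] that by blast
    qed
    show ?thesis using stabilizable_of_sync detectable_of_sync eigs_closed_left_of_sync by simp
  qed
next
  assume "hurwitz A \<or> (stabilizable A B \<and> detectable C A \<and> eigs_closed_left A)"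
  moreover have "stabilizable A B \<and> detectable C A \<and> eigs_closed_left A" if "hurwitz A"
  proof (intro conjI)
    show "stabilizable A B" unfolding stabilizable_def
      using that assms by (intro bexI[of _ "0\<^sub>m 1 n"]) auto
    show "detectable C A" unfolding detectable_def
      using that assms by (intro bexI[of _ "0\<^sub>m n 1"]) auto
    show "eigs_closed_left A" using that by (auto simp: hurwitz_def eigs_closed_left_def less_imp_le)
  qed
  ultimately show "scale_free_sync_solvable A B C"
    using scale_free_sync_solvable_if[OF assms] by blast
qed

end
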